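(* Let $\sigma$ be a permutation and $w\in\mathcal{R}(\sigma)$. If $\sigma$ is vexillary, then for all $i,j\ge 1$ and $k\geq 0$: the cell $(i,j)$ of $P(w)$ contains the entry $(i+j-1)+k$ if and only if $(i+k,j+k)\in D(\sigma)$ and $k=r(i+k,j+k)$. Furthermore, if the set consisting of the cells $(i+k,j+k)$ for entries $(i+j-1)+k$, $k\ge 0$, in cells $(i,j)$ of $P(w)$ is the diagram of a vexillary permutation, then $\sigma$ is vexillary.
   Context: Words and permutations. A word $w = w_1\cdots w_m$ with letters in $[n-1]$ defines the permutation $\sigma = s_{w_1}\cdots s_{w_m}\in\mathfrak{S}_n$, where $s_i=(i\ i{+}1)$ and transpositions act on positions, composed from the left: start with the one-line word $12\cdots n$ and for $k=1,\dots,m$ swap the entries in positions $w_k$ and $w_k+1$ (e.g. $1213$ gives $3241$). The word is reduced if $m = \mathrm{inv}(\sigma)$; $\mathcal{R}(\sigma)$ is the set of reduced words of $\sigma$. A permutation is vexillary if it is 2143-avoiding, i.e. its one-line word has no subsequence in the same relative order as $2143$. Edelman--Greene insertion. Tableaux are in English notation, cell $(i,j)$ in row $i$ and column $j$. To insert $x_0$ into a tableau $P$ with strictly increasing rows $P_1,P_2,\dots$ (rows beyond the last are empty), do for $i=0,1,2,\dots$: if $x_i>z$ for all $z\in P_{i+1}$, place $x_i$ at the end of $P_{i+1}$ and stop; if $x_i\in P_{i+1}$, leave row $P_{i+1}$ unchanged and insert $x_{i+1}=x_i+1$ in $P_{i+2}$; otherwise let $z'$ be the least element of $P_{i+1}$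 with $z'>x_i$, replace it by $x_i$, and insert $x_{i+1}=z'$ in $P_{i+2}$. For a word $w=w_1\cdots w_m$, let $P^{(0)}=\emptyset$ and let $P^{(k)}$ be the result of inserting $w_k$ in $P^{(k-1)}$. The insertion tableau is $P(w)=P^{(m)}$; for reduced $w$ it is row and column strict, so every entry in a cell $(i,j)$ is of the form $(i+j-1)+k$ with $k\ge 0$. Diagram. The permutation matrix $M(\sigma)$ has 1s exactly in entries $(\sigma(i),i)$ (row $\sigma(i)$, column $i$). The (Rothe) diagram $D(\sigma)$ is the set of cells not weakly east (in the same row) nor weakly south (in the same column) of a 1-entry, i.e. $D(\sigma)=\{(r,c): r<\sigma(c),\ c<\sigma^{-1}(r)\}$. For $(a,b)\in D(\sigma)$, the rank $r(a,b)$ is the number of 1s north-west of $(a,b)$ in $M(\sigma)$ (1-entries in a row above $a$ and a column left of $b$). *)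

theory Defs
  imports "HOL-Combinatorics.Permutations" "HOL-Library.Sublist"
begin

section \<open>Words, permutations and patterns\<close>

text \<open>An element of the symmetric group on \<open>n\<close> letters is a function \<open>\<sigma>\<close> with
  \<open>\<sigma> permutes {1..n}\<close>. Swapping the entries in positions \<open>k\<close> and \<open>k + 1\<close> of the
  one-line word of \<open>\<sigma>\<close> is precomposition with the transposition, so the letters of a
  word act from left to right. For example, the word \<open>1213\<close> gives \<open>3241\<close>.\<close>

definition word_perm :: "nat list \<Rightarrow> nat \<Rightarrow> nat" where
  "word_perm w = foldl (\<lambda>\<sigma> k. \<sigma> \<circ> Transposition.transpose k (k + 1)) id w"

definition inv_number :: "nat \<Rightarrow> (nat \<Rightarrow> nat) \<Rightarrow> nat" where
  "inv_number n \<sigma> = card {(i, j). i \<in> {1..n} \<and> j \<in> {1..n} \<and> i < j \<and> \<sigma> j < \<sigma> i}"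

definition reduced_words :: "nat \<Rightarrow> (nat \<Rightarrow> nat) \<Rightarrow> nat list set" where
  "reduced_words n \<sigma> =
     {w. set w \<subseteq> {1..n - 1} \<and> word_perm w = \<sigma> \<and> length w = inv_number n \<sigma>}"

definition one_line :: "nat \<Rightarrow> (nat \<Rightarrow> nat) \<Rightarrow> nat list" where
  "one_line n \<sigma> = map \<sigma> [1..<n + 1]"

definition same_relative_order :: "nat list \<Rightarrow> nat list \<Rightarrow> bool" where
  "same_relative_order xs ys \<longleftrightarrow> length xs = length ys \<and>
     (\<forall>i < length xs. \<forall>j < length xs. xs ! i < xs ! j \<longleftrightarrow> ys ! i < ys ! j)"

definition vexillary :: "nat \<Rightarrow> (nat \<Rightarrow> nat) \<Rightarrow> bool" where
  "vexillary n \<sigma> \<longleftrightarrow>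
     \<not> (\<exists>xs. subseq xs (one_line n \<sigma>) \<and> same_relative_order xs [2, 1, 4, 3])"


section \<open>Edelman--Greene insertion\<close>

text \<open>A tableau is the list of its rows, from top to bottom. In the last branch at most one
  entry of the row equals \<open>z'\<close>, since rows are strictly increasing.\<close>

fun EG_insert :: "nat \<Rightarrow> nat list list \<Rightarrow> nat list list" where
  "EG_insert x [] = [[x]]"
| "EG_insert x (row # P) =
     (if \<forall>z \<in> set row. z < x then (row @ [x]) # P
      else if x \<in> set row then row # EG_insert (x + 1) P
      else let z' = Min {z \<in> set row. x < z}
           in map (\<lambda>z. if z = z' then x else z) row # EG_insert z' P)"

definition insertion_tableau :: "nat list \<Rightarrow> nat list list" where
  "insertion_tableau w = foldl (\<lambda>P x. EG_insert x P) [] w"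

text \<open>Cells are numbered from 1, whereas \<open>(!)\<close> counts from 0.\<close>

definition cell_contains :: "nat list list \<Rightarrow> nat \<Rightarrow> nat \<Rightarrow> nat \<Rightarrow> bool" where
  "cell_contains P i j x \<longleftrightarrow> 1 \<le> i \<and> i \<le> length P \<and>
     1 \<le> j \<and> j \<le> length (P ! (i - 1)) \<and> P ! (i - 1) ! (j - 1) = x"


section \<open>Rothe diagrams\<close>

definition matrix_ones :: "nat \<Rightarrow> (nat \<Rightarrow> nat) \<Rightarrow> (nat \<times> nat) set" where
  "matrix_ones n \<sigma> = {(\<sigma> i, i) | i. i \<in> {1..n}}"

definition diagram :: "nat \<Rightarrow> (nat \<Rightarrow> nat) \<Rightarrow> (nat \<times> nat) set" where
  "diagram n \<sigma> =
     {(r, c). r \<in> {1..n} \<and> c \<in> {1..n} \<and> r < \<sigma> c \<and> c < inv \<sigma> r}"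

definition rank :: "nat \<Rightarrow> (nat \<Rightarrow> nat) \<Rightarrow> nat \<Rightarrow> nat \<Rightarrow> nat" where
  "rank n \<sigma> a b = card {(r, c) \<in> matrix_ones n \<sigma>. r < a \<and> c < b}"

text \<open>The cells \<open>(i, j)\<close> of \<open>P\<close>, each pushed \<open>k\<close> steps along its diagonal, where
  \<open>k\<close> is the excess of its entry over \<open>i + j - 1\<close>.\<close>

definition shifted_cells :: "nat list list \<Rightarrow> (nat \<times> nat) set" where
  "shifted_cells P =
     {(i + k, j + k) | i j k. 1 \<le> i \<and> 1 \<le> j \<and> cell_contains P i j ((i + j - 1) + k)}"

end

theory Submission
  imports Defs
begin

text \<open>
  A letter of a reduced word creates one inversion, and the whole argument follows the inversions
  through the rows of a tableau. The reading word of a tableau \<open>P\<close> lists its rows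
  from bottom to top. Insertion of \<open>x\<close> changes \<open>reading_word P @ [x]\<close>
  only by moves that preserve the permutation and the length, hence \<open>reading_word
  (insertion_tableau w)\<close> is again a reduced word of \<open>\<sigma>\<close>, and the
  insertion tableau is row and column strict (\<open>insertion_tableau_reading_word\<close>). The
  remaining arguments concern any tableau \<open>P\<close> of this kind.

  Let \<open>lehmer_code \<sigma> c\<close> be the number of cells of the diagram in column
  \<open>c\<close>. For vexillary \<open>\<sigma>\<close> the \<open>i\<close>-th row of
  \<open>P\<close> must be \<open>{c + i - 1 | lehmer_code \<sigma> c \<ge> i}\<close>
  (\<open>vexillary_row_set\<close>): the \<open>i\<close>-th cell from the top of column
  \<open>c\<close> of the diagram contributes the entry \<open>c + i - 1\<close> to row
  \<open>i\<close>. The proof removes the top row \<open>R\<close> and writes \<open>\<sigma> =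
  \<tau> \<circ> \<pi>\<close> with \<open>\<pi>\<close> the permutation of the increasing word
  \<open>R\<close>. This \<open>\<pi>\<close> sends \<open>j \<in> R\<close> to \<open>j +
  1\<close>, where the code of \<open>\<tau>\<close> is one less than that of
  \<open>\<sigma>\<close> at \<open>j\<close>; all other codes are moved unchanged. So
  \<open>R\<close> consists of positions with nonzero code, and all rests on the converse, that
  every position with nonzero code belongs to \<open>R\<close> (\<open>vexillary_top_row\<close>).
  Two counts meet: column strictness bounds the number of cells in each row of the diagram by the
  length of \<open>R\<close> (\<open>card_left_greater_tableau\<close>), and avoidance of 2143
  makes the rows of the diagram a chain of sets, so that some row meets all nonempty columns. Once
  \<open>R\<close> is known, a 2143 pattern of \<open>\<tau>\<close> would yield one of
  \<open>\<sigma>\<close>, and the induction goes on.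

  The row description translates into the first claim as follows. Let \<open>(r, c)\<close> be the
  \<open>i\<close>-th cell of column \<open>c\<close>. The values below \<open>r\<close> stand
  either to the left of \<open>c\<close>, where the rank counts them, or to the right, where there
  are \<open>i - 1\<close> of them; so \<open>r = i + k\<close> with \<open>k\<close> the rank.
  For vexillary \<open>\<sigma>\<close> a column \<open>c' < c\<close> has fewer than
  \<open>i\<close> cells exactly if \<open>\<sigma> c' < r\<close>, so \<open>k\<close> of the
  columns before \<open>c\<close> are skipped in row \<open>i\<close> and the entry stands in
  column \<open>j = c - k\<close> of \<open>P\<close>.

  For the second claim, the set of shifted cells determines a tableau
  (\<open>shifted_cells_determine_cells\<close>), because the shift does not decrease along a
  diagonal. If the shifted cells of \<open>P(w)\<close> form the diagram of a vexillary
  \<open>\<tau>\<close>, then by the first claim they are also the shifted cells of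
  \<open>P(v)\<close> for a reduced word \<open>v\<close> of \<open>\<tau>\<close>. So \<open>P(w)
  = P(v)\<close>, both have the same reading word, and \<open>\<sigma> = \<tau>\<close>.

  All permutations are functions on the natural numbers, so positions and values also range over
  \<open>0\<close> and over numbers above \<open>n\<close>; permutations of \<open>{1..n}\<close>
  have no inversions there.
\<close>


section \<open>Permutations of words\<close>

lemma word_perm_Nil [simp]: "word_perm [] = id"
  by (simp add: word_perm_def)

lemma foldl_transpose_comp:
  "foldl (\<lambda>\<sigma> k. \<sigma> \<circ> Transposition.transpose k (k + 1)) (\<tau> \<circ> \<rho>) w =
   \<tau> \<circ> foldl (\<lambda>\<sigma> k. \<sigma> \<circ> Transposition.transpose k (k + 1)) \<rho> w"
  by (induction w arbitrary: \<rho>) (simp_all add: comp_assoc)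

lemma word_perm_append: "word_perm (u @ v) = word_perm u \<circ> word_perm v"
  using foldl_transpose_comp[of "word_perm u" id v] by (simp add: word_perm_def)

lemma word_perm_single: "word_perm [x] = Transposition.transpose x (Suc x)"
  by (simp add: word_perm_def)

lemma word_perm_Cons: "word_perm (x # w) = Transposition.transpose x (Suc x) \<circ> word_perm w"
  using word_perm_append[of "[x]" w] by (simp add: word_perm_single)

lemma word_perm_snoc: "word_perm (w @ [x]) = word_perm w \<circ> Transposition.transpose x (Suc x)"
  by (simp add: word_perm_append word_perm_single)

lemma bij_word_perm: "bij (word_perm w)"
proof (induction w)
  case (Cons x w)
  then show ?case unfolding word_perm_Cons by (rule bij_comp) simp
qed (metis bij_id word_perm_Nil)

lemma inj_word_perm: "inj (word_perm w)"
  using bij_word_perm by (rule bij_is_inj)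

lemma word_perm_fixes:
  assumes "\<And>z. z \<in> set w \<Longrightarrow> y \<noteq> z \<and> y \<noteq> Suc z"
  shows "word_perm w y = y"
  using assms by (induction w) (auto simp: word_perm_Cons transpose_def)

text \<open>Conjugation of a transposition. This one fact covers both the commutation and the braid
  relations used for insertion.\<close>

lemma comp_transpose_commute:
  assumes "inj f" "f x = x'" "f y = y'"
  shows "f \<circ> Transposition.transpose x y = Transposition.transpose x' y' \<circ> f"
proof
  fix z
  have "f z = x' \<longleftrightarrow> z = x" "f z = y' \<longleftrightarrow> z = y"
    using assms by (auto dest: injD)
  then show "(f \<circ> Transposition.transpose x y) z = (Transposition.transpose x' y' \<circ> f) z"
    using assms by (auto simp: transpose_def)
qed


section \<open>Reduced words as chains of ascents\<close>

definition inversions :: "(nat \<Rightarrow> nat) \<Rightarrow> (nat \<times> nat) set" where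
  "inversions \<sigma> = {(i, j). i < j \<and> \<sigma> j < \<sigma> i}"

text \<open>The letters of the word, applied to \<open>\<tau>\<close> one after the other, each swap
  an increasing pair of neighbours. Unlike the comparison of lengths, this splits along
  concatenation, with \<open>\<tau>\<close> keeping track of the prefix.\<close>

fun ascents :: "(nat \<Rightarrow> nat) \<Rightarrow> nat list \<Rightarrow> bool" where
  "ascents \<tau> [] = True"
| "ascents \<tau> (x # w) \<longleftrightarrow> \<tau> x < \<tau> (Suc x) \<and> ascents (\<tau> \<circ> Transposition.transpose x (Suc x)) w"

lemma ascents_append: "ascents \<tau> (u @ v) \<longleftrightarrow> ascents \<tau> u \<and> ascents (\<tau> \<circ> word_perm u) v"
  by (induction u arbitrary: \<tau>) (auto simp: word_perm_Cons comp_assoc)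

lemma transpose_Suc_less_iff:
  assumes "i < j" "(i, j) \<noteq> (x, Suc x)"
  shows "Transposition.transpose x (Suc x) i < Transposition.transpose x (Suc x) j"
  using assms by (auto simp: transpose_def split: if_splits)

text \<open>Swapping two neighbours preserves the relative position of every other pair, so the
  inversions are carried along and only the swapped pair is new.\<close>

lemma inversions_comp_transpose:
  assumes "\<tau> x < \<tau> (Suc x)"
  defines "s \<equiv> Transposition.transpose x (Suc x)"
  shows "inversions (\<tau> \<circ> s) = insert (x, Suc x) (map_prod s s ` inversions \<tau>)"
    and "(x, Suc x) \<notin> map_prod s s ` inversions \<tau>"
proof -
  have ss: "s (s i) = i" for i by (simp add: s_def)
  show "inversions (\<tau> \<circ> s) = insert (x, Suc x) (map_prod s s ` inversions \<tau>)"
  proof (intro set_eqI, clarify)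
    fix i j
    show "(i, j) \<in> inversions (\<tau> \<circ> s) \<longleftrightarrow>
      (i, j) \<in> insert (x, Suc x) (map_prod s s ` inversions \<tau>)"
    proof (cases "(i, j) = (x, Suc x)")
      case True
      then show ?thesis using assms by (simp add: inversions_def)
    next
      case False
      have "(i, j) \<in> map_prod s s ` inversions \<tau> \<longleftrightarrow> (s i, s j) \<in> inversions \<tau>"
        by (force simp: ss intro!: image_eqI[of _ _ "(s i, s j)"])
      moreover have "i < j \<Longrightarrow> s i < s j"
        using transpose_Suc_less_iff False unfolding s_def by blast
      moreover have "s i < s j \<Longrightarrow> \<tau> (s j) < \<tau> (s i) \<Longrightarrow> i < j"
        using transpose_Suc_less_iff[of "s i" "s j" x] assms(1) ss
        unfolding s_def by (metis not_less_iff_gr_or_eq prod.inject)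
      ultimately show ?thesis using False by (auto simp: inversions_def)
    qed
  qed
  show "(x, Suc x) \<notin> map_prod s s ` inversions \<tau>"
    using ss by (auto simp: inversions_def s_def transpose_def split: if_splits)
qed

lemma inversions_ascent:
  assumes "\<tau> x < \<tau> (Suc x)" "finite (inversions \<tau>)"
  shows "finite (inversions (\<tau> \<circ> Transposition.transpose x (Suc x)))"
    and "card (inversions (\<tau> \<circ> Transposition.transpose x (Suc x))) = Suc (card (inversions \<tau>))"
proof -
  let ?s = "Transposition.transpose x (Suc x)"
  have "inj (map_prod ?s ?s)" by (simp add: prod.inj_map)
  then have "card (map_prod ?s ?s ` inversions \<tau>) = card (inversions \<tau>)"
    by (intro card_image) (blast intro: inj_on_subset)
  then show "finite (inversions (\<tau> \<circ> ?s))"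
    and "card (inversions (\<tau> \<circ> ?s)) = Suc (card (inversions \<tau>))"
    using inversions_comp_transpose[OF assms(1)] assms(2) by simp_all
qed

lemma inversions_descent:
  assumes "\<tau> (Suc x) < \<tau> x" "finite (inversions \<tau>)"
  shows "finite (inversions (\<tau> \<circ> Transposition.transpose x (Suc x)))"
    and "card (inversions \<tau>) = Suc (card (inversions (\<tau> \<circ> Transposition.transpose x (Suc x))))"
proof -
  let ?s = "Transposition.transpose x (Suc x)"
  let ?\<rho> = "\<tau> \<circ> ?s"
  have \<tau>: "?\<rho> \<circ> ?s = \<tau>" by (simp add: comp_assoc)
  have asc: "?\<rho> x < ?\<rho> (Suc x)" using assms(1) by simp
  have "inj (map_prod ?s ?s)" by (simp add: prod.inj_map)
  moreover have "finite (map_prod ?s ?s ` inversions ?\<rho>)"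
    using inversions_comp_transpose(1)[OF asc] assms(2) \<tau> by (metis finite_insert)
  ultimately show fin: "finite (inversions ?\<rho>)"
    by (meson finite_imageD inj_on_subset subset_UNIV)
  show "card (inversions \<tau>) = Suc (card (inversions ?\<rho>))"
    using inversions_ascent(2)[OF asc fin] \<tau> by simp
qed

text \<open>Each letter changes the number of inversions by one, up for an ascent and down for a
  descent; hence the maximal number is reached exactly by words all of whose letters are
  ascents.\<close>

lemma card_inversions_comp_word_perm:
  assumes "finite (inversions \<tau>)" "inj \<tau>"
  shows "finite (inversions (\<tau> \<circ> word_perm w)) \<and>
    card (inversions (\<tau> \<circ> word_perm w)) \<le> card (inversions \<tau>) + length w \<and>
    (card (inversions (\<tau> \<circ> word_perm w)) = card (inversions \<tau>) + length w \<longleftrightarrow> ascents \<tau> w)"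
  using assms
proof (induction w arbitrary: \<tau>)
  case Nil
  then show ?case by simp
next
  case (Cons x w)
  define \<rho> where "\<rho> = \<tau> \<circ> Transposition.transpose x (Suc x)"
  have "inj \<rho>" using Cons.prems by (simp add: \<rho>_def inj_compose)
  have eq: "\<tau> \<circ> word_perm (x # w) = \<rho> \<circ> word_perm w"
    by (simp add: \<rho>_def word_perm_Cons comp_assoc)
  have "\<tau> x \<noteq> \<tau> (Suc x)" using Cons.prems(2) by (metis injD n_not_Suc_n)
  then consider "\<tau> x < \<tau> (Suc x)" | "\<tau> (Suc x) < \<tau> x" by linarith
  then show ?case
  proof cases
    case 1
    note \<rho> = inversions_ascent[OF 1 Cons.prems(1), folded \<rho>_def]
    from 1 Cons.IH[OF \<rho>(1) \<open>inj \<rho>\<close>] \<rho>(2) show ?thesis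
      unfolding eq ascents.simps \<rho>_def[symmetric] by simp
  next
    case 2
    note \<rho> = inversions_descent[OF 2 Cons.prems(1), folded \<rho>_def]
    from 2 Cons.IH[OF \<rho>(1) \<open>inj \<rho>\<close>] \<rho>(2) show ?thesis
      unfolding eq ascents.simps \<rho>_def[symmetric] by simp
  qed
qed

text \<open>Intrinsic form of reducedness, without a bound on the letters: it depends only on the
  length of the word and on its permutation, so it survives all moves that preserve these
  two.\<close>

definition reduced :: "nat list \<Rightarrow> bool" where
  "reduced w \<longleftrightarrow> length w = card (inversions (word_perm w))"

lemma inversions_id [simp]: "inversions id = {}"
  by (auto simp: inversions_def)

lemma reduced_iff_ascents: "reduced w \<longleftrightarrow> ascents id w"
  using card_inversions_comp_word_perm[of id w] by (auto simp: reduced_def)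

lemma reduced_append:
  "reduced (u @ v) \<longleftrightarrow> reduced u \<and> ascents (word_perm u) v"
  by (simp add: reduced_iff_ascents ascents_append)

lemma reduced_cong:
  "word_perm u = word_perm v \<Longrightarrow> length u = length v \<Longrightarrow> reduced u \<longleftrightarrow> reduced v"
  by (simp add: reduced_def)


section \<open>The permutation of a strictly increasing word\<close>

text \<open>Split the increasing word \<open>R\<close> into maximal runs \<open>a, a + 1, \<dots>, b
  - 1\<close>. A run takes the entry at position \<open>a\<close> to position \<open>b\<close> and
  shifts the entries in between to the left. Thus \<open>word_perm R b\<close> is the start of the
  run that ends just before \<open>b\<close>, and equals \<open>b\<close> if there is no such
  run.\<close>

lemma increasing_word_perm:
  assumes "sorted_wrt (<) R"
  shows increasing_word_perm_in: "j \<in> set R \<Longrightarrow> word_perm R j = Suc j"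
    and increasing_word_perm_notin:
      "b \<notin> set R \<Longrightarrow> word_perm R b \<le> b \<and> {word_perm R b..<b} \<subseteq> set R"
proof -
  have "(\<forall>j \<in> set R. word_perm R j = Suc j) \<and>
    (\<forall>b. b \<notin> set R \<longrightarrow> word_perm R b \<le> b \<and> {word_perm R b..<b} \<subseteq> set R)"
    using assms
  proof (induction R rule: rev_induct)
    case Nil
    then show ?case by simp
  next
    case (snoc x R)
    have less: "z < x" if "z \<in> set R" for z
      using snoc.prems that by (auto simp: sorted_wrt_append)
    have IH: "\<forall>j \<in> set R. word_perm R j = Suc j"
      "\<And>b. b \<notin> set R \<Longrightarrow> word_perm R b \<le> b \<and> {word_perm R b..<b} \<subseteq> set R"
      using snoc by (auto simp: sorted_wrt_append)
    have [simp]: "word_perm R (Suc x) = Suc x"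
      using less by (intro word_perm_fixes) fastforce
    have x: "x \<notin> set R" using less by blast
    have "word_perm (R @ [x]) j = Suc j" if "j \<in> set (R @ [x])" for j
      using that IH(1) less[of j] by (auto simp: word_perm_snoc transpose_def)
    moreover have "word_perm (R @ [x]) b \<le> b \<and> {word_perm (R @ [x]) b..<b} \<subseteq> set (R @ [x])"
      if "b \<notin> set (R @ [x])" for b
      using that IH(2)[OF x] IH(2)[of b]
      by (auto simp: word_perm_snoc transpose_def less_Suc_eq)
    ultimately show ?case by blast
  qed
  then show "j \<in> set R \<Longrightarrow> word_perm R j = Suc j"
    and "b \<notin> set R \<Longrightarrow> word_perm R b \<le> b \<and> {word_perm R b..<b} \<subseteq> set R"
    by blast+
qed

text \<open>The entry that a run carries from position \<open>a\<close> to position \<open>b\<close>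
  passes all entries that the run shifts to the left; in a reduced word it is smaller than each of
  them.\<close>

lemma ascents_increasing_word:
  assumes "sorted_wrt (<) R" "ascents \<tau> R" "b \<notin> set R" "word_perm R b \<le> j" "j < b"
  shows "\<tau> (word_perm R b) < \<tau> (Suc j)"
  using assms
proof (induction R arbitrary: b rule: rev_induct)
  case Nil
  then show ?case by simp
next
  case (snoc x R)
  have less: "z < x" if "z \<in> set R" for z
    using snoc.prems that by (auto simp: sorted_wrt_append)
  have sorted: "sorted_wrt (<) R" and asc: "ascents \<tau> R"
    and last: "\<tau> (word_perm R x) < \<tau> (word_perm R (Suc x))"
    using snoc.prems by (auto simp: sorted_wrt_append ascents_append)
  have [simp]: "word_perm R (Suc x) = Suc x"
    using less by (intro word_perm_fixes) fastforce
  have x: "x \<notin> set R" using less by blast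
  show ?case
  proof (cases "b = Suc x")
    case True
    then have "word_perm (R @ [x]) b = word_perm R x" by (simp add: word_perm_snoc)
    then show ?thesis
      using True last snoc.prems snoc.IH[OF sorted asc x] by (cases "j = x") auto
  next
    case False
    then have "word_perm (R @ [x]) b = word_perm R b"
      using snoc.prems by (auto simp: word_perm_snoc transpose_def)
    then show ?thesis
      using snoc.prems snoc.IH[OF sorted asc, of b] by simp
  qed
qed


section \<open>Tableaux and their reading words\<close>

definition reading_word :: "nat list list \<Rightarrow> nat list" where
  "reading_word P = concat (rev P)"

text \<open>Column strictness of two adjacent rows, the upper one \<open>R\<close> and the lower one
  \<open>S\<close>, in terms of their sets of entries. For strictly increasing rows it says that
  \<open>S\<close> is not longer than \<open>R\<close> and that each entry of \<open>S\<close> is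
  larger than the entry of \<open>R\<close> above it. The counting form needs no positions, which
  shift during insertion.\<close>

definition column_strict :: "nat set \<Rightarrow> nat set \<Rightarrow> bool" where
  "column_strict R S \<longleftrightarrow> (\<forall>v. card {s \<in> S. s \<le> v} \<le> card {r \<in> R. r < v})"

fun top_row :: "nat list list \<Rightarrow> nat set" where
  "top_row [] = {}"
| "top_row (R # P) = set R"

fun tableau :: "nat list list \<Rightarrow> bool" where
  "tableau [] = True"
| "tableau (R # P) \<longleftrightarrow>
     R \<noteq> [] \<and> sorted_wrt (<) R \<and> column_strict (set R) (top_row P) \<and> tableau P"

lemma finite_top_row [simp]: "finite (top_row P)"
  by (cases P) auto

lemma reading_word_Nil [simp]: "reading_word [] = []"
  by (simp add: reading_word_def)

lemma reading_word_Cons [simp]: "reading_word (R # P) = reading_word P @ R"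
  by (simp add: reading_word_def)


section \<open>Insertion preserves tableaux and permutations\<close>

text \<open>The effect of insertion on the set of entries of one row. The removed set is empty if
  \<open>x\<close> is appended, and otherwise contains just the bumped entry.\<close>

definition row_bump :: "nat \<Rightarrow> nat set \<Rightarrow> nat set" where
  "row_bump x S = (if x \<in> S then S
     else insert x (S - {z \<in> S. x < z \<and> (\<forall>y \<in> S. x < y \<longrightarrow> z \<le> y)}))"

lemma Min_larger:
  fixes S :: "nat set"
  assumes "finite S" "\<exists>z \<in> S. x < z"
  defines "z \<equiv> Min {z \<in> S. x < z}"
  shows "z \<in> S" "x < z" "\<forall>y \<in> S. x < y \<longrightarrow> z \<le> y"
proof -
  have "z \<in> {z \<in> S. x < z}"
    unfolding z_def using assms(1,2) by (intro Min_in) auto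
  then show "z \<in> S" "x < z" by simp_all
  show "\<forall>y \<in> S. x < y \<longrightarrow> z \<le> y" using assms(1) by (simp add: z_def)
qed

lemma top_row_EG_insert: "top_row (EG_insert x P) = row_bump x (top_row P)"
proof (cases P)
  case Nil
  then show ?thesis by (simp add: row_bump_def)
next
  case (Cons R Q)
  consider (append) "\<forall>z \<in> set R. z < x" | (present) "x \<in> set R"
    | (bump) "\<exists>z \<in> set R. x < z" "x \<notin> set R"
    by (metis linorder_neqE_nat)
  then show ?thesis
  proof cases
    case bump
    define z' where "z' = Min {z \<in> set R. x < z}"
    have z': "z' \<in> set R" "x < z'" and le: "\<forall>y \<in> set R. x < y \<longrightarrow> z' \<le> y"
      using Min_larger[of "set R" x] bump(1) unfolding z'_def by auto
    have "{z \<in> set R. x < z \<and> (\<forall>y \<in> set R. x < y \<longrightarrow> z \<le> y)} = {z'}"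
      using z' le by (auto intro: antisym)
    moreover have "set (map (\<lambda>z. if z = z' then x else z) R) = insert x (set R - {z'})"
      using z' by auto
    moreover have "\<not> (\<forall>z \<in> set R. z < x)" using z' by (meson less_asym)
    then have "EG_insert x (R # Q) = map (\<lambda>z. if z = z' then x else z) R # EG_insert z' Q"
      using bump(2) by (simp add: Let_def z'_def)
    ultimately show ?thesis using bump(2) unfolding Cons
      by (simp add: row_bump_def del: set_map EG_insert.simps)
  qed (use Cons in \<open>auto simp: row_bump_def\<close>)
qed

text \<open>The count up to \<open>v\<close> grows only if \<open>y\<close> is at most
  \<open>v\<close> and new, and the entry that it replaces, if any, lies above
  \<open>v\<close>.\<close>

lemma card_row_bump:
  assumes "finite S"
  shows "card {s \<in> row_bump y S. s \<le> v} \<le>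
    card {s \<in> S. s \<le> v} + (if y \<le> v \<and> (\<forall>s \<in> S. \<not> (y \<le> s \<and> s \<le> v)) then 1 else 0)"
proof (cases "y \<in> S \<or> \<not> y \<le> v")
  case True
  then have "{s \<in> row_bump y S. s \<le> v} \<subseteq> {s \<in> S. s \<le> v}"
    by (auto simp: row_bump_def)
  with assms have "card {s \<in> row_bump y S. s \<le> v} \<le> card {s \<in> S. s \<le> v}"
    by (intro card_mono) auto
  then show ?thesis by simp
next
  case y: False
  show ?thesis
  proof (cases "\<exists>s \<in> S. y \<le> s \<and> s \<le> v")
    case True
    define z where "z = Min {s \<in> S. y < s}"
    from True y obtain s where s: "s \<in> S" "y < s" "s \<le> v" by (metis le_neq_implies_less)
    have z: "z \<in> S" "y < z" "\<forall>s \<in> S. y < s \<longrightarrow> z \<le> s"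
      using Min_larger[of S y] s(1,2) assms unfolding z_def by auto
    have "{s \<in> row_bump y S. s \<le> v} \<subseteq> insert y ({s \<in> S. s \<le> v} - {z})"
      using y z by (auto simp: row_bump_def)
    then have "card {s \<in> row_bump y S. s \<le> v} \<le> card (insert y ({s \<in> S. s \<le> v} - {z}))"
      using assms by (intro card_mono) auto
    also have "\<dots> \<le> Suc (card ({s \<in> S. s \<le> v} - {z}))"
      by (rule card_insert_le_m1) simp_all
    also have "\<dots> = card {s \<in> S. s \<le> v}"
      using assms z s by (intro card_Suc_Diff1) auto
    finally show ?thesis by simp
  next
    case False
    have "{s \<in> row_bump y S. s \<le> v} \<subseteq> insert y {s \<in> S. s \<le> v}"
      by (auto simp: row_bump_def)
    then have "card {s \<in> row_bump y S. s \<le> v} \<le> card (insert y {s \<in> S. s \<le> v})"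
      using assms by (intro card_mono) auto
    also have "\<dots> \<le> Suc (card {s \<in> S. s \<le> v})"
      by (rule card_insert_le_m1) simp_all
    finally show ?thesis using y False by auto
  qed
qed

text \<open>The classical fact that the bumping path moves weakly to the left. The row
  \<open>R\<close> becomes \<open>R'\<close> and passes \<open>y\<close> on to the next row
  \<open>S\<close>. Where the count of \<open>S\<close> up to \<open>v\<close> grows,
  \<open>S\<close> has no entries between \<open>y\<close> and \<open>v\<close>, so its count up to
  \<open>v\<close> is already attained at \<open>u\<close>; and there \<open>R'\<close> has the
  additional entry \<open>x\<close> to compensate. When \<open>x\<close> bumps \<open>y\<close>, the
  bound \<open>u\<close> is \<open>y\<close>; when \<open>x\<close> was present in \<open>R\<close>
  and \<open>y = x + 1\<close>, it is \<open>x\<close>.\<close>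

lemma column_strict_row_bump:
  assumes "column_strict R S" "finite R'" "finite S"
    and mono: "\<And>v. card {r \<in> R. r < v} \<le> card {r \<in> R'. r < v}"
    and x: "x \<in> R'" "x < y" "u \<le> y" "y \<le> Suc u" "{r \<in> R. r < u} \<subseteq> R' - {x}"
  shows "column_strict R' (row_bump y S)"
  unfolding column_strict_def
proof
  fix v
  have strict: "card {s \<in> S. s \<le> v} \<le> card {r \<in> R. r < v}" for v
    using assms(1) by (simp add: column_strict_def)
  note count = card_row_bump[OF assms(3), of y v]
  show "card {s \<in> row_bump y S. s \<le> v} \<le> card {r \<in> R'. r < v}"
  proof (cases "y \<le> v \<and> (\<forall>s \<in> S. \<not> (y \<le> s \<and> s \<le> v))")
    case True
    have "card {s \<in> S. s \<le> v} \<le> card {s \<in> S. s \<le> u}"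
      using True x assms(3) by (intro card_mono) auto
    also have "\<dots> \<le> card {r \<in> R. r < u}" by (rule strict)
    finally have "card {s \<in> row_bump y S. s \<le> v} \<le> Suc (card {r \<in> R. r < u})"
      using count True by simp
    also have "\<dots> = card (insert x {r \<in> R. r < u})"
      using x(5) finite_subset[OF x(5)] assms(2) by (subst card_insert_disjoint) auto
    also have "\<dots> \<le> card {r \<in> R'. r < v}"
      using x True assms(2) by (intro card_mono) auto
    finally show ?thesis .
  next
    case False
    then have "card {s \<in> row_bump y S. s \<le> v} \<le> card {s \<in> S. s \<le> v}"
      using count by (simp only: if_False add_0_right)
    then show ?thesis using strict[of v] mono[of v] by linarith
  qed
qed

text \<open>Both \<open>x\<close> and \<open>x + 1\<close> lie in \<open>R\<close>, so the
  permutation of \<open>R\<close> shifts \<open>x\<close> and \<open>x + 1\<close> up by one and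
  conjugates one transposition into the next. This is the braid relation in the middle of
  \<open>R\<close>.\<close>

lemma word_perm_row_present:
  assumes "sorted_wrt (<) R" "x \<in> set R" "Suc x \<in> set R"
  shows "word_perm (R @ [x]) = word_perm (Suc x # R)"
  using assms unfolding word_perm_snoc word_perm_Cons
  by (intro comp_transpose_commute inj_word_perm increasing_word_perm_in)

text \<open>The inserted letter \<open>x\<close> commutes with the larger letters \<open>v\<close>,
  and the bumped letter \<open>z\<close> with the smaller letters \<open>u\<close>, as these differ
  from it by at least two.\<close>

lemma word_perm_row_bump:
  assumes "sorted_wrt (<) (u @ z # v)" "\<And>y. y \<in> set u \<Longrightarrow> y < x" "x < z"
  shows "word_perm ((u @ z # v) @ [x]) = word_perm (z # u @ x # v)"
proof -
  have comm: "word_perm w \<circ> Transposition.transpose y (Suc y) =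
      Transposition.transpose y (Suc y) \<circ> word_perm w"
    if "\<And>r. r \<in> set w \<Longrightarrow> Suc r < y \<or> Suc y < r" for w y
    using that by (intro comp_transpose_commute inj_word_perm word_perm_fixes) fastforce+
  have "word_perm v \<circ> Transposition.transpose x (Suc x) =
      Transposition.transpose x (Suc x) \<circ> word_perm v"
    using assms by (intro comm) (fastforce simp: sorted_wrt_append)
  moreover have "word_perm u \<circ> Transposition.transpose z (Suc z) =
      Transposition.transpose z (Suc z) \<circ> word_perm u"
    using assms by (intro comm) fastforce
  ultimately show ?thesis
    by (simp only: append_assoc append_Cons append_Nil word_perm_append word_perm_Cons
        word_perm_Nil comp_id) (metis (no_types) comp_assoc)
qed

text \<open>If \<open>x\<close> were the last letter of a run, position \<open>x + 1\<close> would
  hold the small entry that the run has just moved there, and swapping it back would destroy an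
  inversion. This is why the case of a present letter in the insertion algorithm can pass on
  \<open>x + 1\<close>.\<close>

lemma ascents_row_present:
  assumes "sorted_wrt (<) R" "ascents \<tau> (R @ [x])" "x \<in> set R"
  shows "Suc x \<in> set R"
proof (rule ccontr)
  assume notin: "Suc x \<notin> set R"
  let ?a = "word_perm R (Suc x)"
  have "?a \<noteq> word_perm R x" using inj_word_perm by (metis injD n_not_Suc_n)
  then have "?a \<le> x"
    using increasing_word_perm_notin[OF assms(1) notin] increasing_word_perm_in[OF assms(1,3)]
    by simp
  then have "\<tau> ?a < \<tau> (Suc x)"
    using ascents_increasing_word[OF assms(1) _ notin] assms(2) by (simp add: ascents_append)
  then show False
    using assms(2) increasing_word_perm_in[OF assms(1,3)] by (simp add: ascents_append)
qed

text \<open>Row by row, the inserted letter \<open>x\<close> is moved through the row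
  \<open>R\<close> to the front, where it has become the letter \<open>y\<close> that is inserted
  into the rest. Reducedness is passed on to the rest since it depends only on length and
  permutation and is inherited by prefixes.\<close>

lemma EG_insert_tableau:
  assumes "tableau P" "reduced (reading_word P @ [x])"
  shows "tableau (EG_insert x P) \<and>
    word_perm (reading_word (EG_insert x P)) = word_perm (reading_word P @ [x]) \<and>
    length (reading_word (EG_insert x P)) = Suc (length (reading_word P))"
  using assms
proof (induction P arbitrary: x)
  case Nil
  then show ?case by (auto simp: column_strict_def)
next
  case (Cons R P)
  have R: "R \<noteq> []" "sorted_wrt (<) R" "column_strict (set R) (top_row P)" "tableau P"
    using Cons.prems by auto
  \<comment> \<open>The common part of the two cases in which a letter \<open>y\<close> is passed on to the next row.\<close>
  have step: "tableau (EG_insert x (R # P)) \<and>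
      word_perm (reading_word (EG_insert x (R # P))) = word_perm (reading_word (R # P) @ [x]) \<and>
      length (reading_word (EG_insert x (R # P))) = Suc (length (reading_word (R # P)))"
    if EG: "EG_insert x (R # P) = R' # EG_insert y P"
      and perm: "word_perm (R @ [x]) = word_perm (y # R')"
      and R': "sorted_wrt (<) R'" "length R' = length R"
      and strict: "column_strict (set R') (row_bump y (top_row P))" for y R'
  proof -
    have eq: "word_perm (reading_word (R # P) @ [x]) = word_perm ((reading_word P @ [y]) @ R')"
      using perm word_perm_append[of "[y]" R'] by (simp add: word_perm_append comp_assoc)
    then have "reduced ((reading_word P @ [y]) @ R')"
      using Cons.prems(2) R'(2) reduced_cong[OF eq] by simp
    then have "reduced (reading_word P @ [y])" by (simp only: reduced_append)
    note IH = Cons.IH[OF R(4) this]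
    then have "word_perm (reading_word (EG_insert y P) @ R') = word_perm (reading_word (R # P) @ [x])"
      unfolding eq by (simp only: word_perm_append)
    with IH show ?thesis
      using R(1) R' strict unfolding EG by (auto simp: top_row_EG_insert)
  qed
  consider (append) "\<forall>z \<in> set R. z < x" | (present) "x \<in> set R"
    | (bump) "\<exists>z \<in> set R. x < z" "x \<notin> set R"
    by (metis linorder_neqE_nat)
  then show ?case
  proof cases
    case append
    have "card {r \<in> set R. r < v} \<le> card {r \<in> insert x (set R). r < v}" for v
      by (intro card_mono) auto
    then have "column_strict (insert x (set R)) (top_row P)"
      using R(3) le_trans unfolding column_strict_def by blast
    then show ?thesis
      using append R by (simp add: sorted_wrt_append)
  next
    case present
    have "ascents (word_perm (reading_word P)) (R @ [x])"
      using Cons.prems(2) by (simp add: reduced_append)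
    then have "Suc x \<in> set R" using ascents_row_present R(2) present by blast
    then show ?thesis
      using present R
      by (intro step[of R "Suc x"] word_perm_row_present
          column_strict_row_bump[of "set R" _ _ x _ x]) auto
  next
    case bump
    define z where "z = Min {z \<in> set R. x < z}"
    have z: "z \<in> set R" "x < z" and le: "\<forall>y \<in> set R. x < y \<longrightarrow> z \<le> y"
      using Min_larger[of "set R" x] bump(1) unfolding z_def by auto
    from z(1) obtain u v where uv: "R = u @ z # v" by (auto simp: in_set_conv_decomp)
    have u: "y < x" if "y \<in> set u" for y
    proof -
      have "y < z" "y \<noteq> x" using R(2) uv that bump(2) by (auto simp: sorted_wrt_append)
      moreover have "y \<in> set R" using uv that by simp
      ultimately show ?thesis using le by (meson linorder_neqE_nat not_le)
    qed
    let ?R' = "u @ x # v"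
    have map: "map (\<lambda>y. if y = z then x else y) R = ?R'"
      using R(2) uv by (auto simp: sorted_wrt_append intro!: map_idI)
    have set: "set ?R' = insert x (set R - {z})"
      using R(2) uv by (auto simp: sorted_wrt_append)
    have "card {r \<in> set R. r < t} \<le> card {r \<in> insert x (set R - {z}). r < t}" for t
    proof (cases "z < t")
      case True
      have "{r \<in> insert x (set R - {z}). r < t} = insert x ({r \<in> set R. r < t} - {z})"
        using True z by auto
      moreover have "card (insert x ({r \<in> set R. r < t} - {z})) = card {r \<in> set R. r < t}"
        using True z bump(2) 
        by (subst card_insert_disjoint) (auto intro!: card_Suc_Diff1 simp del: card_Diff_insert)
      ultimately show ?thesis by simp
    next
      case False
      then show ?thesis by (intro card_mono) auto
    qed
    then have strict: "column_strict (set ?R') (row_bump z (top_row P))"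
      using z bump(2) R(3) unfolding set
      by (intro column_strict_row_bump[of "set R" _ _ x _ z]) auto
    have "\<not> (\<forall>z \<in> set R. z < x)" using z by (meson less_asym)
    then have "EG_insert x (R # P) = ?R' # EG_insert z P"
      using bump(2) by (simp only: EG_insert.simps if_False Let_def z_def[symmetric] map)
    moreover have "word_perm (R @ [x]) = word_perm (z # ?R')"
      using word_perm_row_bump[of u z v x] R(2) u z(2) uv by simp
    moreover have "sorted_wrt (<) ?R'"
      using R(2) uv u z(2) by (fastforce simp: sorted_wrt_append)
    ultimately show ?thesis using strict uv by (intro step) auto
  qed
qed

lemma insertion_tableau_snoc:
  "insertion_tableau (w @ [x]) = EG_insert x (insertion_tableau w)"
  by (simp add: insertion_tableau_def)

lemma insertion_tableau_reading_word:
  assumes "reduced w"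
  shows "tableau (insertion_tableau w) \<and>
    word_perm (reading_word (insertion_tableau w)) = word_perm w \<and>
    length (reading_word (insertion_tableau w)) = length w"
  using assms
proof (induction w rule: rev_induct)
  case Nil
  then show ?case by (simp add: insertion_tableau_def)
next
  case (snoc x w)
  let ?P = "insertion_tableau w"
  have IH: "tableau ?P" "word_perm (reading_word ?P) = word_perm w"
    "length (reading_word ?P) = length w"
    using snoc by (auto simp: reduced_append)
  have "reduced (reading_word ?P @ [x])"
    using snoc.prems IH reduced_cong[of "reading_word ?P @ [x]" "w @ [x]"]
    by (simp add: word_perm_append)
  from EG_insert_tableau[OF IH(1) this] IH show ?case
    by (simp add: insertion_tableau_snoc word_perm_append)
qed

lemma EG_insert_entries_ge:
  assumes "\<forall>R \<in> set P. \<forall>y \<in> set R. m \<le> y" "m \<le> x"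
  shows "\<forall>R \<in> set (EG_insert x P). \<forall>y \<in> set R. m \<le> y"
  using assms
proof (induction P arbitrary: x)
  case (Cons R P)
  consider (append) "\<forall>z \<in> set R. z < x" | (present) "x \<in> set R"
    | (bump) "\<exists>z \<in> set R. x < z" "x \<notin> set R"
    by (metis linorder_neqE_nat)
  then show ?case
  proof cases
    case present
    have "\<forall>R \<in> set (EG_insert (x + 1) P). \<forall>y \<in> set R. m \<le> y"
      using Cons.prems by (intro Cons.IH) simp_all
    then show ?thesis using present Cons.prems by auto
  next
    case bump
    define z where "z = Min {z \<in> set R. x < z}"
    have "m \<le> z" using Min_larger(1)[of "set R" x] bump(1) Cons.prems(1) unfolding z_def by simp
    then have "\<forall>R \<in> set (EG_insert z P). \<forall>y \<in> set R. m \<le> y"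
      using Cons.prems by (intro Cons.IH) simp_all
    then show ?thesis using bump Cons.prems by (auto simp: Let_def z_def)
  qed (use Cons.prems in auto)
qed simp

lemma insertion_tableau_entries_ge:
  assumes "\<forall>x \<in> set w. m \<le> x"
  shows "\<forall>R \<in> set (insertion_tableau w). \<forall>y \<in> set R. m \<le> y"
  using assms
proof (induction w rule: rev_induct)
  case Nil
  then show ?case by (simp add: insertion_tableau_def)
next
  case (snoc x w)
  then show ?case unfolding insertion_tableau_snoc by (intro EG_insert_entries_ge) auto
qed


section \<open>The Lehmer code along a row\<close>

text \<open>The diagram has the cells \<open>(\<sigma> d, c)\<close> in column \<open>c\<close>, one
  for each of the counted positions \<open>d\<close>.\<close>

definition lehmer_code :: "(nat \<Rightarrow> nat) \<Rightarrow> nat \<Rightarrow> nat" where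
  "lehmer_code \<sigma> c = card {d. c < d \<and> \<sigma> d < \<sigma> c}"

lemma finite_less_vimage:
  fixes \<sigma> :: "nat \<Rightarrow> nat"
  assumes "inj \<sigma>"
  shows "finite {d. \<sigma> d < v}"
  using finite_vimageI[OF finite_lessThan[of v] assms] by (simp add: vimage_def lessThan_def)

lemma finite_lehmer_code_set [simp]:
  fixes \<sigma> :: "nat \<Rightarrow> nat"
  shows "inj \<sigma> \<Longrightarrow> finite {d. c < d \<and> \<sigma> d < \<sigma> c}"
  by (rule finite_subset[OF _ finite_less_vimage[of \<sigma> "\<sigma> c"]]) auto

lemma lehmer_code_pos_iff: "inj \<sigma> \<Longrightarrow> 0 < lehmer_code \<sigma> c \<longleftrightarrow> (\<exists>d > c. \<sigma> d < \<sigma> c)"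
  by (auto simp: lehmer_code_def card_gt_0_iff)

lemma lehmer_code_id [simp]: "lehmer_code id c = 0"
  by (auto simp: lehmer_code_def)

lemma increasing_word_perm_ge:
  assumes "sorted_wrt (<) R" "b \<notin> set R" "b < d"
  shows "b < word_perm R d"
proof (cases "d \<in> set R")
  case True
  then show ?thesis using assms increasing_word_perm_in by simp
next
  case False
  then show ?thesis using assms increasing_word_perm_notin[OF assms(1) False]
    by (metis atLeastLessThan_iff not_le subsetD)
qed

text \<open>The first position \<open>b\<close> after \<open>j\<close> that is not in
  \<open>R\<close> ends the run of \<open>j\<close>. If its image were beyond \<open>j\<close>, the
  predecessor of the image would be in the run and would have the same image.\<close>

lemma run_end:
  assumes "sorted_wrt (<) R" "j \<in> set R"
  obtains b where "b \<notin> set R" "j < b" "word_perm R b \<le> j"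
proof -
  let ?ok = "\<lambda>b. j < b \<and> b \<notin> set R"
  obtain b0 where "b0 \<notin> {..j} \<union> set R"
    using ex_new_if_finite[of "{..j} \<union> set R"] infinite_UNIV_nat by auto
  then have "?ok b0" by auto
  define b where "b = (LEAST b. ?ok b)"
  have b: "j < b" "b \<notin> set R"
    using LeastI[of ?ok, OF \<open>?ok b0\<close>] unfolding b_def by auto
  have run: "i \<in> set R" if "j \<le> i" "i < b" for i
    using not_less_Least[of i ?ok] that assms(2) unfolding b_def by (metis le_neq_implies_less)
  have "word_perm R b \<le> j"
  proof (rule ccontr)
    assume *: "\<not> word_perm R b \<le> j"
    define i where "i = word_perm R b - 1"
    have i: "j \<le> i" "i < b" "word_perm R b = Suc i"
      using * increasing_word_perm_notin[OF assms(1) b(2)] by (auto simp: i_def)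
    then have "word_perm R i = word_perm R b"
      using run increasing_word_perm_in[OF assms(1)] by simp
    then show False using inj_word_perm i(2) by (metis injD less_irrefl)
  qed
  with b show thesis by (intro that)
qed

text \<open>The entry at \<open>j\<close> comes from \<open>j + 1\<close>. The same smaller entries
  remain to its right, and the entry carried to the end of its run is a new one.\<close>

lemma lehmer_code_comp_increasing_in:
  assumes "inj \<tau>" "sorted_wrt (<) R" "ascents \<tau> R" "j \<in> set R"
  shows "lehmer_code (\<tau> \<circ> word_perm R) j = Suc (lehmer_code \<tau> (Suc j))"
proof -
  let ?\<pi> = "word_perm R"
  obtain b where b: "b \<notin> set R" "j < b" "?\<pi> b \<le> j" using run_end assms(2,4) by blast
  have run: "{?\<pi> b..<b} \<subseteq> set R" using increasing_word_perm_notin assms(2) b(1) by blast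
  have [simp]: "?\<pi> j = Suc j" using increasing_word_perm_in assms by blast
  have "?\<pi> ` {d. j < d \<and> \<tau> (?\<pi> d) < \<tau> (Suc j)} =
    insert (?\<pi> b) {e. Suc j < e \<and> \<tau> e < \<tau> (Suc j)}" (is "?L = ?R")
  proof
    show "?L \<subseteq> ?R"
    proof clarsimp
      fix d assume d: "j < d" "?\<pi> d \<noteq> ?\<pi> b"
      show "Suc j < ?\<pi> d"
      proof (cases "d \<in> set R")
        case True
        then show ?thesis using d(1) increasing_word_perm_in assms(2) by simp
      next
        case False
        then have "b < d" using run d b(3)
          by (metis atLeastLessThan_iff le_trans less_imp_le linorder_neqE_nat subsetD)
        then show ?thesis using increasing_word_perm_ge[OF assms(2) b(1), of d] b(2) by simp
      qed
    qed
    have "e \<in> ?L" if e: "Suc j < e" "\<tau> e < \<tau> (Suc j)" for e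
    proof -
      obtain d where d: "e = ?\<pi> d" using bij_word_perm by (metis bij_pointE)
      have "j < d"
        using e(1) d increasing_word_perm_in[OF assms(2), of d]
          increasing_word_perm_notin[OF assms(2), of d]
        by (cases "d \<in> set R") auto
      then show ?thesis using d e by auto
    qed
    moreover have "\<tau> (?\<pi> b) < \<tau> (Suc j)" using ascents_increasing_word assms(2,3) b by blast
    ultimately show "?R \<subseteq> ?L" using b(2) by auto
  qed
  then have "card ?L = Suc (card {e. Suc j < e \<and> \<tau> e < \<tau> (Suc j)})"
    using b(3) finite_lehmer_code_set[OF assms(1)] by simp
  moreover have "card ?L = lehmer_code (\<tau> \<circ> ?\<pi>) j"
    unfolding lehmer_code_def by (subst card_image) (auto intro: inj_on_subset[OF inj_word_perm])
  ultimately show ?thesis by (simp add: lehmer_code_def)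
qed

text \<open>The entry at \<open>b\<close> was carried there along a run, passing larger entries
  only.\<close>

lemma lehmer_code_comp_increasing_notin:
  assumes "sorted_wrt (<) R" "ascents \<tau> R" "b \<notin> set R"
  shows "lehmer_code (\<tau> \<circ> word_perm R) b = lehmer_code \<tau> (word_perm R b)"
proof -
  let ?\<pi> = "word_perm R"
  have \<pi>b: "?\<pi> b \<le> b" "{?\<pi> b..<b} \<subseteq> set R"
    using increasing_word_perm_notin assms by blast+
  have "?\<pi> ` {d. b < d \<and> \<tau> (?\<pi> d) < \<tau> (?\<pi> b)} = {e. ?\<pi> b < e \<and> \<tau> e < \<tau> (?\<pi> b)}"
    (is "?L = ?R")
  proof
    show "?L \<subseteq> ?R"
      using increasing_word_perm_ge[OF assms(1,3)] \<pi>b(1) by (auto intro: le_less_trans)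
    show "?R \<subseteq> ?L"
    proof clarify
      fix e assume e: "?\<pi> b < e" "\<tau> e < \<tau> (?\<pi> b)"
      obtain d where d: "e = ?\<pi> d" using bij_word_perm by (metis bij_pointE)
      have "\<not> d < b"
      proof
        assume "d < b"
        show False
        proof (cases "d \<in> set R")
          case True
          then have "e = Suc d" using d increasing_word_perm_in assms(1) by blast
          then show False
            using ascents_increasing_word[OF assms, of d] e \<open>d < b\<close> by simp
        next
          case False
          then have "e \<le> d" using d increasing_word_perm_notin assms(1) by blast
          then have "d \<in> {?\<pi> b..<b}" using e \<open>d < b\<close> by simp
          then show False using False \<pi>b(2) by blast
        qed
      qed
      moreover have "d \<noteq> b" using d e by auto
      ultimately show "e \<in> ?L" using d e by auto
    qed
  qed
  moreover have "card ?L = lehmer_code (\<tau> \<circ> ?\<pi>) b"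
    unfolding lehmer_code_def by (subst card_image) (auto intro: inj_on_subset[OF inj_word_perm])
  ultimately show ?thesis by (simp add: lehmer_code_def)
qed


section \<open>A bound on the rows of the diagram\<close>

text \<open>The row \<open>\<sigma> p\<close> of the diagram, as the set of its columns.\<close>

definition left_greater :: "(nat \<Rightarrow> nat) \<Rightarrow> nat \<Rightarrow> nat set" where
  "left_greater \<sigma> p = {d. d < p \<and> \<sigma> p < \<sigma> d}"

lemma finite_left_greater [simp]: "finite (left_greater \<sigma> p)"
  by (rule finite_subset[of _ "{..<p}"]) (auto simp: left_greater_def)

text \<open>The permutation of \<open>R\<close> acts on the entry that ends at position
  \<open>p\<close>. If \<open>p\<close> ends a run that starts at \<open>a\<close>, the entry moves
  from \<open>a\<close> to \<open>p\<close> and gains at most the \<open>p - a\<close> larger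
  entries of the run, and just as many elements of \<open>R\<close> lie between \<open>a\<close> and
  \<open>p\<close>. If \<open>p \<in> R\<close>, the entry moves from \<open>p + 1\<close> to
  \<open>p\<close> and gains nothing, and column strictness makes up for the stricter bound on the
  counted elements.\<close>

lemma card_left_greater_comp_increasing:
  assumes "sorted_wrt (<) R" "column_strict (set R) S" "finite S"
    and \<tau>: "\<And>q. card (left_greater \<tau> q) \<le> card {s \<in> S. s < q}"
  shows "card (left_greater (\<tau> \<circ> word_perm R) p) \<le> card {r \<in> set R. r < p}"
proof -
  let ?\<pi> = "word_perm R" let ?\<sigma> = "\<tau> \<circ> word_perm R"
  have strict: "card {s \<in> S. s \<le> v} \<le> card {r \<in> set R. r < v}" for v
    using assms(2) by (simp add: column_strict_def)
  show ?thesis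
  proof (cases "p \<in> set R")
    case True
    then have [simp]: "?\<pi> p = Suc p" using increasing_word_perm_in assms(1) by blast
    have "?\<pi> d < Suc p" if "d < p" for d
      using that increasing_word_perm_in[OF assms(1), of d]
        increasing_word_perm_notin[OF assms(1), of d]
      by (cases "d \<in> set R") auto
    then have "?\<pi> ` left_greater ?\<sigma> p \<subseteq> left_greater \<tau> (Suc p)"
      by (auto simp: left_greater_def)
    then have "card (left_greater ?\<sigma> p) \<le> card (left_greater \<tau> (Suc p))"
      by (intro card_inj_on_le[of ?\<pi>]) (auto intro: inj_on_subset[OF inj_word_perm])
    also have "\<dots> \<le> card {s \<in> S. s \<le> p}" using \<tau>[of "Suc p"] by (simp add: less_Suc_eq_le)
    also have "\<dots> \<le> card {r \<in> set R. r < p}" by (rule strict)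
    finally show ?thesis .
  next
    case False
    define a where "a = ?\<pi> p"
    have a: "a \<le> p" "{a..<p} \<subseteq> set R"
      using increasing_word_perm_notin[OF assms(1) False] by (auto simp: a_def)
    have "?\<pi> d < a" if "d < a" for d
    proof (cases "d \<in> set R")
      case True
      then have "?\<pi> d = Suc d" using increasing_word_perm_in assms(1) by blast
      moreover have "?\<pi> d \<noteq> ?\<pi> p" using inj_word_perm that a(1) by (metis injD not_le)
      ultimately show ?thesis using that by (simp add: a_def)
    next
      case False
      then show ?thesis using that increasing_word_perm_notin[OF assms(1)] le_less_trans by blast
    qed
    \<comment> \<open>Positions before the run start \<open>a\<close> stay before \<open>a\<close>; the run itself is \<open>{a..<p}\<close>.\<close>
    then have "?\<pi> ` (left_greater ?\<sigma> p - {a..<p}) \<subseteq> left_greater \<tau> a"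
      by (auto simp: left_greater_def a_def)
    then have "card (left_greater ?\<sigma> p - {a..<p}) \<le> card (left_greater \<tau> a)"
      by (intro card_inj_on_le[of ?\<pi>]) (auto intro: inj_on_subset[OF inj_word_perm])
    also have "\<dots> \<le> card {s \<in> S. s < a}" by (rule \<tau>)
    also have "\<dots> \<le> card {s \<in> S. s \<le> a}" using assms(3) by (intro card_mono) auto
    also have "\<dots> \<le> card {r \<in> set R. r < a}" by (rule strict)
    finally have "card (left_greater ?\<sigma> p - {a..<p}) + card {a..<p} \<le>
      card {r \<in> set R. r < a} + card {a..<p}" by simp
    also have "\<dots> = card ({r \<in> set R. r < a} \<union> {a..<p})"
      by (intro card_Un_disjoint[symmetric]) auto
    also have "\<dots> \<le> card {r \<in> set R. r < p}" using a by (intro card_mono) auto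
    finally have "card (left_greater ?\<sigma> p - {a..<p}) + card {a..<p} \<le> card {r \<in> set R. r < p}" .
    moreover have "card (left_greater ?\<sigma> p) \<le> card ((left_greater ?\<sigma> p - {a..<p}) \<union> {a..<p})"
      by (intro card_mono) auto
    moreover have "\<dots> \<le> card (left_greater ?\<sigma> p - {a..<p}) + card {a..<p}"
      by (rule card_Un_le)
    ultimately show ?thesis by linarith
  qed
qed

text \<open>With \<open>p\<close> large, no row of the diagram has more cells than the top row of
  \<open>P\<close>. The bound on the position of the elements counted in the top row is what makes
  the induction over the rows of \<open>P\<close> possible.\<close>

lemma card_left_greater_tableau:
  assumes "tableau P"
  shows "card (left_greater (word_perm (reading_word P)) p) \<le> card {r \<in> top_row P. r < p}"
  using assms
proof (induction P arbitrary: p)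
  case Nil
  then show ?case by (simp add: left_greater_def card_eq_0_iff)
next
  case (Cons R P)
  then have "card (left_greater (word_perm (reading_word P) \<circ> word_perm R) p) \<le>
      card {r \<in> set R. r < p}"
    by (intro card_left_greater_comp_increasing[where S = "top_row P"]) simp_all
  then have "card (left_greater (word_perm (reading_word (R # P))) p) \<le>
      card {r \<in> top_row (R # P). r < p}"
    by (simp only: reading_word_Cons word_perm_append top_row.simps)
  then show ?case .
qed


section \<open>Vexillary permutations\<close>

definition avoids_2143 :: "(nat \<Rightarrow> nat) \<Rightarrow> bool" where
  "avoids_2143 \<sigma> \<longleftrightarrow>
     (\<nexists>a b c d. a < b \<and> b < c \<and> c < d \<and> \<sigma> b < \<sigma> a \<and> \<sigma> a < \<sigma> d \<and> \<sigma> d < \<sigma> c)"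

lemma avoids_2143D:
  "avoids_2143 \<sigma> \<Longrightarrow> a < b \<Longrightarrow> b < c \<Longrightarrow> c < d \<Longrightarrow> \<sigma> b < \<sigma> a \<Longrightarrow> \<sigma> a < \<sigma> d \<Longrightarrow> \<sigma> d < \<sigma> c \<Longrightarrow> False"
  unfolding avoids_2143_def by blast

text \<open>Two incomparable rows \<open>\<sigma> p < \<sigma> q\<close> of the diagram contain
  columns \<open>c\<close> and \<open>c'\<close> that belong to one of them only, and then \<open>c
  < p < c' < q\<close> are the positions of a 2143 pattern.\<close>

lemma left_greater_chain:
  assumes "avoids_2143 \<sigma>" "inj \<sigma>"
  shows "left_greater \<sigma> p \<subseteq> left_greater \<sigma> q \<or> left_greater \<sigma> q \<subseteq> left_greater \<sigma> p"
proof -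
  have "left_greater \<sigma> p \<subseteq> left_greater \<sigma> q \<or> left_greater \<sigma> q \<subseteq> left_greater \<sigma> p"
    if "\<sigma> p < \<sigma> q" for p q
  proof (rule ccontr)
    assume "\<not> ?thesis"
    then obtain c c' where c: "c < p" "\<sigma> p < \<sigma> c" "c \<notin> left_greater \<sigma> q"
      and c': "c' < q" "\<sigma> q < \<sigma> c'" "c' \<notin> left_greater \<sigma> p"
      by (auto simp: left_greater_def)
    have "p < c'"
    proof (rule ccontr)
      assume "\<not> p < c'"
      then consider "c' = p" | "c' < p" by linarith
      then show False using c' that by cases (auto simp: left_greater_def)
    qed
    then have "c < q" using c(1) c'(1) by simp
    then have "\<sigma> c \<noteq> \<sigma> q" using assms(2) by (metis injD less_irrefl)
    moreover have "\<not> \<sigma> q < \<sigma> c" using c(3) \<open>c < q\<close> by (simp add: left_greater_def)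
    ultimately have "\<sigma> c < \<sigma> q" by simp
    then show False using avoids_2143D[OF assms(1) c(1) \<open>p < c'\<close> c'(1) c(2)] c'(2) by blast
  qed
  moreover have "\<sigma> p = \<sigma> q \<Longrightarrow> p = q" using assms(2) by (rule injD)
  ultimately show ?thesis by (metis linorder_neqE_nat order_refl)
qed

text \<open>Each nonempty column meets some row, and among the rows that meet the columns of
  \<open>F\<close>, which form a chain, the largest meets all of them.\<close>

lemma finite_subset_left_greater:
  assumes "avoids_2143 \<sigma>" "inj \<sigma>" "finite F" "\<And>c. c \<in> F \<Longrightarrow> 0 < lehmer_code \<sigma> c"
  shows "\<exists>p. F \<subseteq> left_greater \<sigma> p"
  using assms(3,4)
proof (induction F rule: finite_induct)
  case (insert c F)
  then obtain p where p: "F \<subseteq> left_greater \<sigma> p" by auto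
  have "0 < lehmer_code \<sigma> c" using insert.prems by simp
  then obtain q where q: "c \<in> left_greater \<sigma> q"
    using lehmer_code_pos_iff[OF assms(2)] by (auto simp: left_greater_def)
  from left_greater_chain[OF assms(1,2), of p q] p q show ?case by blast
qed simp

text \<open>A position \<open>c\<close> with nonzero code outside \<open>R\<close> would give a set
  of \<open>card (set R) + 1\<close> nonempty columns that are all met by one row of the diagram,
  which has at most \<open>card (set R)\<close> cells.\<close>

lemma vexillary_top_row:
  assumes "tableau (R # P)" "reduced (reading_word (R # P))"
  defines "\<sigma> \<equiv> word_perm (reading_word (R # P))"
  assumes "avoids_2143 \<sigma>"
  shows "set R = {c. 0 < lehmer_code \<sigma> c}"
proof
  define \<tau> where "\<tau> = word_perm (reading_word P)"
  have \<sigma>: "\<sigma> = \<tau> \<circ> word_perm R" by (simp add: \<sigma>_def \<tau>_def word_perm_append)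
  have inj: "inj \<sigma>" "inj \<tau>" unfolding \<sigma>_def \<tau>_def by (rule inj_word_perm)+
  have "ascents \<tau> R" using assms(2) by (simp add: reduced_append \<tau>_def)
  then show "set R \<subseteq> {c. 0 < lehmer_code \<sigma> c}"
    using lehmer_code_comp_increasing_in[OF inj(2), of R] assms(1) unfolding \<sigma> by fastforce
  show "{c. 0 < lehmer_code \<sigma> c} \<subseteq> set R"
  proof (rule ccontr)
    assume "\<not> ?thesis"
    then obtain c where c: "0 < lehmer_code \<sigma> c" "c \<notin> set R" by auto
    obtain p where "insert c (set R) \<subseteq> left_greater \<sigma> p"
      using finite_subset_left_greater[OF assms(4) inj(1), of "insert c (set R)"] c
        \<open>set R \<subseteq> {c. 0 < lehmer_code \<sigma> c}\<close> by auto
    then have "card (insert c (set R)) \<le> card (left_greater \<sigma> p)"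
      by (intro card_mono) simp_all
    also have "\<dots> \<le> card {r \<in> set R. r < p}"
      using card_left_greater_tableau[OF assms(1), of p] by (simp only: \<sigma>_def top_row.simps)
    also have "\<dots> \<le> card (set R)" by (intro card_mono) auto
    finally show False using c(2) by simp
  qed
qed

text \<open>Consider a pattern of \<open>\<tau>\<close> with the entries "2", "1", "4", "3". The
  positions of "2" and "4" have nonzero code, so in \<open>\<sigma>\<close> these entries stand one
  place further left, at elements of \<open>R\<close>. If the run of "2" ends before "4", the small
  entry at its end takes the place of "1". Otherwise "2", "1" and "4" lie in one run and are shifted
  together.\<close>

lemma avoids_2143_remove_row:
  assumes "inj \<tau>" "sorted_wrt (<) R" "ascents \<tau> R"
  defines "\<sigma> \<equiv> \<tau> \<circ> word_perm R"
  assumes "avoids_2143 \<sigma>" "set R = {c. 0 < lehmer_code \<sigma> c}"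
  shows "avoids_2143 \<tau>"
  unfolding avoids_2143_def
proof (intro notI, elim exE conjE)
  fix p1 p2 p3 p4
  assume p: "p1 < p2" "p2 < p3" "p3 < p4" "\<tau> p2 < \<tau> p1" "\<tau> p1 < \<tau> p4" "\<tau> p4 < \<tau> p3"
  let ?\<pi> = "word_perm R"
  \<comment> \<open>Positions outside \<open>R\<close> have code zero in \<open>\<sigma>\<close> and hand this code on to \<open>\<tau>\<close>.\<close>
  have shift: "\<exists>q. q \<in> set R \<and> p = Suc q" if "0 < lehmer_code \<tau> p" for p
  proof -
    obtain q where q: "p = ?\<pi> q" using bij_word_perm by (metis bij_pointE)
    have "q \<in> set R"
    proof (rule ccontr)
      assume "q \<notin> set R"
      then have "lehmer_code \<sigma> q = lehmer_code \<tau> p"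
        using lehmer_code_comp_increasing_notin[OF assms(2,3)] unfolding \<sigma>_def q by blast
      then show False using that \<open>q \<notin> set R\<close> assms(6) by simp
    qed
    then show ?thesis using increasing_word_perm_in assms(2) q by blast
  qed
  have "0 < lehmer_code \<tau> p1" "0 < lehmer_code \<tau> p3" using p lehmer_code_pos_iff[OF assms(1)] by auto
  then obtain q1 q3 where q1: "q1 \<in> set R" "p1 = Suc q1" and q3: "q3 \<in> set R" "p3 = Suc q3"
    using shift by metis
  have \<pi>: "?\<pi> q1 = p1" "?\<pi> q3 = p3" using q1 q3 increasing_word_perm_in assms(2) by auto
  \<comment> \<open>The entry "3" either shifts one place to the left or moves right, and stays behind "4".\<close>
  obtain q4 where q4: "p4 = ?\<pi> q4" using bij_word_perm by (metis bij_pointE)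
  have "p4 \<le> Suc q4"
    using q4 increasing_word_perm_in[OF assms(2), of q4]
      increasing_word_perm_notin[OF assms(2), of q4] by (cases "q4 \<in> set R") auto
  then have "q3 < q4" using p q3 by simp
  have order: "\<sigma> q1 < \<sigma> q4" "\<sigma> q4 < \<sigma> q3" using p \<pi> q4 by (simp_all add: \<sigma>_def)
  obtain b where b: "b \<notin> set R" "q1 < b" "?\<pi> b \<le> q1" using run_end assms(2) q1(1) by blast
  have "b \<noteq> q3" using b q3 by blast
  then consider "b < q3" | "q3 < b" by linarith
  then show False
  proof cases
    case 1
    have "\<tau> (?\<pi> b) < \<tau> (Suc q1)" using ascents_increasing_word assms(2,3) b by blast
    then have "\<sigma> b < \<sigma> q1" using \<pi> q1 by (simp add: \<sigma>_def)
    with 1 show False using avoids_2143D[OF assms(5) b(2) _ \<open>q3 < q4\<close>] order by blast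
  next
    case 2
    \<comment> \<open>The position of "1" lies between those of "2" and "4", hence in their run.\<close>
    define q2 where "q2 = p2 - 1"
    have q2: "p2 = Suc q2" "q1 < q2" "q2 < q3" using p q1 q3 by (auto simp: q2_def)
    have "q2 \<in> {?\<pi> b..<b}" using b(3) q2 2 by simp
    then have "q2 \<in> set R" using increasing_word_perm_notin assms(2) b(1) by blast
    then have "\<sigma> q2 < \<sigma> q1"
      using increasing_word_perm_in assms(2) q2(1) p(4) \<pi> by (simp add: \<sigma>_def)
    with q2 show False using avoids_2143D[OF assms(5) _ _ \<open>q3 < q4\<close>] order by blast
  qed
qed

text \<open>Rows are counted from \<open>0\<close>, as by \<open>(!)\<close>, and rows beyond the
  last are empty.\<close>

definition row_set :: "nat list list \<Rightarrow> nat \<Rightarrow> nat set" where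
  "row_set P i = (if i < length P then set (P ! i) else {})"

text \<open>Let \<open>\<sigma>\<close> be the permutation of the tableau and \<open>\<tau>\<close>
  that of the tableau without its top row \<open>R\<close>. The codes of \<open>\<tau>\<close> are
  those of \<open>\<sigma>\<close> at the positions in \<open>R\<close>, lowered by one and shifted
  by one position to the right; all other codes are zero. So the entries \<open>c + i\<close> of row
  \<open>i\<close> for \<open>\<tau>\<close> are those of row \<open>i + 1\<close> for
  \<open>\<sigma>\<close>.\<close>

theorem vexillary_row_set:
  assumes "tableau P" "reduced (reading_word P)" "avoids_2143 (word_perm (reading_word P))"
  shows "row_set P i = {c + i | c. i < lehmer_code (word_perm (reading_word P)) c}"
  using assms
proof (induction P arbitrary: i)
  case Nil
  have "row_set [] i = {c + i | c. i < lehmer_code id c}" by (simp add: row_set_def)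
  then show ?case by (simp only: reading_word_Nil word_perm_Nil)
next
  case (Cons R P)
  define \<tau> where "\<tau> = word_perm (reading_word P)"
  define \<sigma> where "\<sigma> = word_perm (reading_word (R # P))"
  have \<sigma>: "\<sigma> = \<tau> \<circ> word_perm R" by (simp add: \<sigma>_def \<tau>_def word_perm_append)
  have "inj \<tau>" unfolding \<tau>_def by (rule inj_word_perm)
  have R: "sorted_wrt (<) R" "ascents \<tau> R" "tableau P" "reduced (reading_word P)"
    using Cons.prems(1,2) by (auto simp: reduced_append \<tau>_def)
  have top: "set R = {c. 0 < lehmer_code \<sigma> c}"
    using vexillary_top_row[OF Cons.prems] by (simp add: \<sigma>_def)
  have av: "avoids_2143 \<tau>"
    using avoids_2143_remove_row[OF \<open>inj \<tau>\<close> R(1,2)] Cons.prems(3) top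
    unfolding \<sigma>_def[symmetric] \<sigma>[symmetric] by blast
  note code_in = lehmer_code_comp_increasing_in[OF \<open>inj \<tau>\<close> R(1,2), folded \<sigma>]
  show ?case
  proof (cases i)
    case 0
    then show ?thesis using top unfolding \<sigma>_def[symmetric] by (simp add: row_set_def)
  next
    case (Suc k)
    have "{c. k < lehmer_code \<tau> c} = Suc ` {c. Suc k < lehmer_code \<sigma> c}" (is "?L = ?R")
    proof
      show "?L \<subseteq> ?R"
      proof clarify
        fix c assume c: "k < lehmer_code \<tau> c"
        obtain q where q: "c = word_perm R q" using bij_word_perm by (metis bij_pointE)
        have "q \<in> set R"
        proof (rule ccontr)
          assume "q \<notin> set R"
          then have "lehmer_code \<sigma> q = lehmer_code \<tau> c"
            using lehmer_code_comp_increasing_notin[OF R(1,2)] unfolding \<sigma> q by blast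
          then show False using c \<open>q \<notin> set R\<close> top by simp
        qed
        moreover from this have "c = Suc q" using q increasing_word_perm_in[OF R(1)] by simp
        ultimately show "c \<in> ?R" using c code_in[of q] by simp
      qed
      have "k < lehmer_code \<tau> (Suc c)" if "Suc k < lehmer_code \<sigma> c" for c
        using that top code_in[of c] by simp
      then show "?R \<subseteq> ?L" by auto
    qed
    then have "{c + k | c. k < lehmer_code \<tau> c} = {Suc c + k | c. Suc k < lehmer_code \<sigma> c}"
      by (simp only: setcompr_eq_image image_image)
    moreover have "row_set (R # P) i = row_set P k" by (simp add: row_set_def Suc)
    ultimately show ?thesis
      using Cons.IH[OF R(3,4)] av Suc unfolding \<tau>_def[symmetric] \<sigma>_def[symmetric] by simp
  qed
qed


section \<open>Cells of the diagram of a vexillary permutation\<close>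

lemma card_less_nth:
  assumes "sorted_wrt (<) (xs :: nat list)" "j < length xs"
  shows "card {y \<in> set xs. y < xs ! j} = j"
proof -
  have "{y \<in> set xs. y < xs ! j} = (!) xs ` {..<j}"
  proof
    show "{y \<in> set xs. y < xs ! j} \<subseteq> (!) xs ` {..<j}"
    proof clarify
      fix y assume "y \<in> set xs" "y < xs ! j"
      then obtain l where l: "l < length xs" "y = xs ! l" by (auto simp: in_set_conv_nth)
      then have "l < j"
        using \<open>y < xs ! j\<close> assms sorted_wrt_nth_less[OF assms(1), of j l]
        by (metis less_asym less_irrefl linorder_neqE_nat)
      then show "y \<in> (!) xs ` {..<j}" using l by simp
    qed
    show "(!) xs ` {..<j} \<subseteq> {y \<in> set xs. y < xs ! j}"
      using assms sorted_wrt_nth_less[OF assms(1)] by auto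
  qed
  moreover have "inj_on ((!) xs) {..<j}"
    using assms by (intro inj_on_nth) (auto simp: strict_sorted_iff)
  ultimately show ?thesis by (simp add: card_image)
qed

text \<open>Turns the position in a row into a count, so that rows can be handled as sets.\<close>

lemma nth_eq_iff_card_less:
  assumes "sorted_wrt (<) (xs :: nat list)"
  shows "j < length xs \<and> xs ! j = x \<longleftrightarrow> x \<in> set xs \<and> card {y \<in> set xs. y < x} = j"
proof
  assume "x \<in> set xs \<and> card {y \<in> set xs. y < x} = j"
  then obtain l where l: "l < length xs" "xs ! l = x" and j: "card {y \<in> set xs. y < x} = j"
    by (auto simp: in_set_conv_nth)
  have "l = j" using card_less_nth[OF assms l(1)] l(2) j by simp
  with l show "j < length xs \<and> xs ! j = x" by simp
qed (use card_less_nth[OF assms] in auto)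

lemma tableau_row_sorted:
  "tableau P \<Longrightarrow> i < length P \<Longrightarrow> sorted_wrt (<) (P ! i) \<and> P ! i \<noteq> []"
proof (induction P arbitrary: i)
  case (Cons R P)
  then show ?case by (cases i) auto
qed simp

lemma cell_contains_iff_row_set:
  assumes "tableau P" "1 \<le> i" "1 \<le> j"
  shows "cell_contains P i j x \<longleftrightarrow>
    x \<in> row_set P (i - 1) \<and> card {y \<in> row_set P (i - 1). y < x} = j - 1"
proof (cases "i \<le> length P")
  case True
  then have "i - 1 < length P" using assms(2) by simp
  moreover from this have "sorted_wrt (<) (P ! (i - 1))"
    using tableau_row_sorted[OF assms(1)] by blast
  moreover have "j \<le> length (P ! (i - 1)) \<longleftrightarrow> j - 1 < length (P ! (i - 1))"
    using assms(3) by linarith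
  ultimately show ?thesis
    using assms(2,3) True nth_eq_iff_card_less[of "P ! (i - 1)" "j - 1" x]
    unfolding cell_contains_def row_set_def by (simp only: if_True simp_thms)
next
  case False
  then have "\<not> i - 1 < length P" using assms(2) by linarith
  then show ?thesis using False by (simp add: cell_contains_def row_set_def)
qed

text \<open>Let \<open>r = \<sigma> p\<close> be a row that meets column \<open>c\<close>, and
  \<open>c' < c\<close>. If \<open>\<sigma> c' > r\<close>, then all values up to \<open>r\<close>
  to the right of \<open>c\<close> are also smaller than \<open>\<sigma> c'\<close>. If
  \<open>\<sigma> c' < r\<close>, a value smaller than \<open>\<sigma> c'\<close> at a position
  \<open>e\<close> between \<open>c'\<close> and \<open>c\<close> would make \<open>c' < e < c <
  p\<close> the positions of a 2143 pattern.\<close>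

lemma lehmer_code_le_iff:
  assumes "avoids_2143 \<sigma>" "inj \<sigma>" "c' < c" "c < p" "\<sigma> p < \<sigma> c"
  shows "lehmer_code \<sigma> c' \<le> card {d. c < d \<and> \<sigma> d < \<sigma> p} \<longleftrightarrow> \<sigma> c' < \<sigma> p"
proof
  let ?V = "{d. c < d \<and> \<sigma> d < \<sigma> p}" let ?U = "{d. c' < d \<and> \<sigma> d < \<sigma> c'}"
  have fin: "finite ?V" by (rule finite_subset[OF _ finite_less_vimage[OF assms(2)]]) auto
  show "\<sigma> c' < \<sigma> p" if "lehmer_code \<sigma> c' \<le> card ?V"
  proof (rule ccontr)
    assume "\<not> \<sigma> c' < \<sigma> p"
    moreover have "\<sigma> c' \<noteq> \<sigma> p" using assms(2-4) by (metis injD less_asym)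
    ultimately have "\<sigma> p < \<sigma> c'" by simp
    then have "insert p ?V \<subseteq> ?U" using assms(3,4) by auto
    then have "card (insert p ?V) \<le> lehmer_code \<sigma> c'"
      unfolding lehmer_code_def using finite_lehmer_code_set[OF assms(2)] by (intro card_mono)
    then show False using that fin by simp
  qed
  show "lehmer_code \<sigma> c' \<le> card ?V" if "\<sigma> c' < \<sigma> p"
    unfolding lehmer_code_def
  proof (intro card_mono fin subsetI CollectI)
    fix e assume "e \<in> ?U"
    then have e: "c' < e" "\<sigma> e < \<sigma> c'" by simp_all
    have "\<not> e < c" using avoids_2143D[OF assms(1) e(1) _ assms(4) e(2) that assms(5)] by blast
    moreover have "e \<noteq> c" using e(2) that assms(5) by auto
    ultimately show "c < e \<and> \<sigma> e < \<sigma> p" using e(2) that by auto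
  qed
qed

lemma card_smaller_values:
  fixes \<sigma> :: "nat \<Rightarrow> nat"
  assumes "bij \<sigma>"
  shows "card {d. \<sigma> d < r} = r"
proof -
  have "\<sigma> ` {d. \<sigma> d < r} = \<sigma> ` (\<sigma> -` {..<r})" by auto
  also have "\<dots> = {..<r}" by (rule surj_image_vimage_eq[OF bij_is_surj[OF assms]])
  finally have "\<sigma> ` {d. \<sigma> d < r} = {..<r}" .
  then have "card (\<sigma> ` {d. \<sigma> d < r}) = r" by simp
  then show ?thesis
    using card_image[of \<sigma> "{d. \<sigma> d < r}"] bij_is_inj[OF assms] inj_on_subset by (metis subset_UNIV)
qed

text \<open>The cell in row \<open>\<sigma> p\<close> of column \<open>c\<close> has
  \<open>m\<close> cells above it. The first equation splits the values below \<open>\<sigma>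
  p\<close> by their position relative to \<open>c\<close>, the second splits the positions before
  \<open>c\<close> by their value relative to \<open>\<sigma> p\<close>, that is, by
  \<open>lehmer_code_le_iff\<close>, according to whether they have more than \<open>m\<close>
  cells.\<close>

lemma cell_coordinates:
  assumes "avoids_2143 \<sigma>" "bij \<sigma>" "c < p" "\<sigma> p < \<sigma> c"
  defines "m \<equiv> card {d. c < d \<and> \<sigma> d < \<sigma> p}"
  shows "\<sigma> p = card {d. d < c \<and> \<sigma> d < \<sigma> p} + m"
    and "c = card {d. d < c \<and> \<sigma> d < \<sigma> p} + card {d. d < c \<and> m < lehmer_code \<sigma> d}"
proof -
  have inj: "inj \<sigma>" using assms(2) by (rule bij_is_inj)
  have "d \<noteq> c" if "\<sigma> d < \<sigma> p" for d using that assms(4) by auto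
  then have "{d. \<sigma> d < \<sigma> p} = {d. d < c \<and> \<sigma> d < \<sigma> p} \<union> {d. c < d \<and> \<sigma> d < \<sigma> p}"
    by (auto simp: nat_neq_iff)
  moreover have "finite {d. d < c \<and> \<sigma> d < \<sigma> p}" "finite {d. c < d \<and> \<sigma> d < \<sigma> p}"
    using finite_less_vimage[OF inj] by (auto elim: rev_finite_subset)
  moreover have "{d. d < c \<and> \<sigma> d < \<sigma> p} \<inter> {d. c < d \<and> \<sigma> d < \<sigma> p} = {}" by auto
  ultimately have "card {d. \<sigma> d < \<sigma> p} = card {d. d < c \<and> \<sigma> d < \<sigma> p} + m"
    by (simp only: card_Un_disjoint m_def)
  then show "\<sigma> p = card {d. d < c \<and> \<sigma> d < \<sigma> p} + m"
    using card_smaller_values[OF assms(2)] by simp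
  have "m < lehmer_code \<sigma> d \<longleftrightarrow> \<not> \<sigma> d < \<sigma> p" if "d < c" for d
    using lehmer_code_le_iff[OF assms(1) inj that assms(3,4)] unfolding m_def[symmetric]
    by (metis not_le)
  then have "{..<c} = {d. d < c \<and> \<sigma> d < \<sigma> p} \<union> {d. d < c \<and> m < lehmer_code \<sigma> d}"
    and "{d. d < c \<and> \<sigma> d < \<sigma> p} \<inter> {d. d < c \<and> m < lehmer_code \<sigma> d} = {}"
    by auto
  then have "card {..<c} =
      card {d. d < c \<and> \<sigma> d < \<sigma> p} + card {d. d < c \<and> m < lehmer_code \<sigma> d}"
    by (simp only: card_Un_disjoint finite_Collect_conjI finite_Collect_less_nat disjI1)
  then show "c = card {d. d < c \<and> \<sigma> d < \<sigma> p} + card {d. d < c \<and> m < lehmer_code \<sigma> d}" by simp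
qed

lemma ex_cell_in_column:
  assumes "inj \<sigma>" "m < lehmer_code \<sigma> c"
  shows "\<exists>p > c. \<sigma> p < \<sigma> c \<and> card {d. c < d \<and> \<sigma> d < \<sigma> p} = m"
proof -
  let ?D = "{d. c < d \<and> \<sigma> d < \<sigma> c}"
  define xs where "xs = sorted_list_of_set (\<sigma> ` ?D)"
  have fin: "finite ?D" by (rule finite_lehmer_code_set[OF assms(1)])
  have xs: "set xs = \<sigma> ` ?D" "sorted_wrt (<) xs" using fin by (simp_all add: xs_def)
  have "length xs = lehmer_code \<sigma> c"
    unfolding xs_def lehmer_code_def using assms(1) by (simp add: card_image inj_on_subset)
  with assms(2) have m: "m < length xs" by simp
  then have "xs ! m \<in> \<sigma> ` ?D" using xs(1) nth_mem by blast
  then obtain p where p: "c < p" "\<sigma> p < \<sigma> c" "xs ! m = \<sigma> p" by auto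
  have "{y \<in> set xs. y < xs ! m} = \<sigma> ` {d. c < d \<and> \<sigma> d < \<sigma> p}"
    using p by (auto simp: xs(1))
  then have "card {d. c < d \<and> \<sigma> d < \<sigma> p} = m"
    using card_less_nth[OF xs(2) m] assms(1) by (simp add: card_image inj_on_subset)
  with p show ?thesis by blast
qed

lemma permutes_atLeast1_fixes:
  fixes \<sigma> :: "nat \<Rightarrow> nat"
  assumes "\<sigma> permutes {1..n}"
  shows "\<sigma> 0 = 0" "n < i \<Longrightarrow> \<sigma> i = i" "i \<le> n \<Longrightarrow> \<sigma> i \<le> n" "0 < i \<Longrightarrow> 0 < \<sigma> i"
proof -
  show 0: "\<sigma> 0 = 0" and "n < i \<Longrightarrow> \<sigma> i = i"
    using permutes_not_in[OF assms] by auto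
  show "i \<le> n \<Longrightarrow> \<sigma> i \<le> n"
    using permutes_in_image[OF assms, of i] 0 by (cases "i = 0") auto
  show "0 < i \<Longrightarrow> 0 < \<sigma> i"
    using permutes_inj[OF assms] 0 by (metis gr0I injD less_irrefl)
qed

lemma permutes_inversion_bounds:
  fixes \<sigma> :: "nat \<Rightarrow> nat"
  assumes "\<sigma> permutes {1..n}" "i < j" "\<sigma> j < \<sigma> i"
  shows "1 \<le> i" "j \<le> n"
proof -
  note outside = permutes_atLeast1_fixes[OF assms(1)]
  show "1 \<le> i" using outside(1) assms(3) by (cases i) auto
  show "j \<le> n"
  proof (rule ccontr)
    assume "\<not> j \<le> n"
    then show False using outside(2)[of j] outside(2)[of i] outside(3)[of i] assms(2,3)
      by (cases "i \<le> n") auto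
  qed
qed

text \<open>Membership in the diagram without the inverse permutation: \<open>p\<close> is the
  position of the value \<open>r\<close>.\<close>

lemma diagram_iff:
  assumes "\<sigma> permutes {1..n}"
  shows "(r, c) \<in> diagram n \<sigma> \<longleftrightarrow>
    1 \<le> r \<and> (\<exists>p. r = \<sigma> p \<and> c < p \<and> r < \<sigma> c)"
proof
  assume "(r, c) \<in> diagram n \<sigma>"
  then show "1 \<le> r \<and> (\<exists>p. r = \<sigma> p \<and> c < p \<and> r < \<sigma> c)"
    using permutes_inverses(1)[OF assms] by (auto simp: diagram_def intro!: exI[of _ "inv \<sigma> r"])
next
  assume "1 \<le> r \<and> (\<exists>p. r = \<sigma> p \<and> c < p \<and> r < \<sigma> c)"
  then obtain p where p: "1 \<le> r" "r = \<sigma> p" "c < p" "r < \<sigma> c" by blast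
  have "1 \<le> c" "p \<le> n" using permutes_inversion_bounds[OF assms p(3)] p by auto
  moreover have "\<sigma> c \<le> n" using permutes_atLeast1_fixes(3)[OF assms, of c] p(3) \<open>p \<le> n\<close> by simp
  ultimately show "(r, c) \<in> diagram n \<sigma>"
    using p permutes_inverses(2)[OF assms] by (auto simp: diagram_def)
qed

text \<open>The set on the left also has the fixed point \<open>0\<close> as an element, which the
  rank does not count.\<close>

lemma card_northwest:
  assumes "\<sigma> permutes {1..n}" "1 \<le> r" "1 \<le> c" "c \<le> Suc n"
  shows "card {d. d < c \<and> \<sigma> d < r} = Suc (rank n \<sigma> r c)"
proof -
  have "{(r', c'). (r', c') \<in> matrix_ones n \<sigma> \<and> r' < r \<and> c' < c} =
      (\<lambda>d. (\<sigma> d, d)) ` {d. 1 \<le> d \<and> d < c \<and> \<sigma> d < r}"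
    using assms(4) by (auto simp: matrix_ones_def)
  moreover have "inj_on (\<lambda>d. (\<sigma> d, d)) A" for A by (auto simp: inj_on_def)
  ultimately have "rank n \<sigma> r c = card {d. 1 \<le> d \<and> d < c \<and> \<sigma> d < r}"
    unfolding rank_def by (simp add: card_image)
  moreover have "{d. d < c \<and> \<sigma> d < r} = insert 0 {d. 1 \<le> d \<and> d < c \<and> \<sigma> d < r}"
    using assms(2,3) permutes_atLeast1_fixes(1)[OF assms(1)] by (auto simp: not_less_eq_eq)
  moreover have "finite {d. 1 \<le> d \<and> d < c \<and> \<sigma> d < r}"
    by (rule finite_subset[of _ "{..<c}"]) auto
  ultimately show ?thesis by simp
qed

theorem vexillary_tableau_cells:
  assumes "\<sigma> permutes {1..n}" "avoids_2143 \<sigma>"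
    and "tableau P" "reduced (reading_word P)" "word_perm (reading_word P) = \<sigma>"
    and "1 \<le> i" "1 \<le> j"
  shows "cell_contains P i j ((i + j - 1) + k) \<longleftrightarrow>
    (i + k, j + k) \<in> diagram n \<sigma> \<and> k = rank n \<sigma> (i + k) (j + k)"
proof -
  define c where "c = j + k"
  \<comment> \<open>The entry \<open>(i + j - 1) + k\<close> is \<open>c + m\<close>: column \<open>c\<close> of the diagram, and the row with number \<open>m\<close>
    counted from \<open>0\<close>.\<close>
  define m where "m = i - 1"
  have bij: "bij \<sigma>" using assms(1) by (rule permutes_bij)
  have inj: "inj \<sigma>" using bij by (rule bij_is_inj)
  have rows: "row_set P m = {c + m | c. m < lehmer_code \<sigma> c}"
    using vexillary_row_set[OF assms(3,4)] assms(2,5) by simp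
  have "{y \<in> row_set P m. y < c + m} = (\<lambda>d. d + m) ` {d. d < c \<and> m < lehmer_code \<sigma> d}"
    by (auto simp: rows)
  then have "card {y \<in> row_set P m. y < c + m} = card {d. d < c \<and> m < lehmer_code \<sigma> d}"
    by (simp add: card_image)
  moreover have "c + m \<in> row_set P m \<longleftrightarrow> m < lehmer_code \<sigma> c" by (auto simp: rows)
  moreover have "(i + j - 1) + k = c + m" using assms(6,7) by (simp add: c_def m_def)
  ultimately have cell: "cell_contains P i j ((i + j - 1) + k) \<longleftrightarrow>
      m < lehmer_code \<sigma> c \<and> card {d. d < c \<and> m < lehmer_code \<sigma> d} = j - 1"
    using cell_contains_iff_row_set[OF assms(3,6,7)] unfolding m_def by simp
  have c: "1 \<le> c" using assms(7) by (simp add: c_def)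
  show ?thesis
  proof
    assume "cell_contains P i j ((i + j - 1) + k)"
    then have *: "m < lehmer_code \<sigma> c" "card {d. d < c \<and> m < lehmer_code \<sigma> d} = j - 1" using cell by auto
    then obtain p where p: "c < p" "\<sigma> p < \<sigma> c" "card {d. c < d \<and> \<sigma> d < \<sigma> p} = m"
      using ex_cell_in_column[OF inj] by blast
    note coord = cell_coordinates[OF assms(2) bij p(1,2)]
    have "1 \<le> \<sigma> p" using permutes_atLeast1_fixes(4)[OF assms(1)] p(1) by (simp add: Suc_leI)
    have "c \<le> Suc n" using permutes_inversion_bounds(2)[OF assms(1) p(1,2)] p(1) by simp
    note nw = card_northwest[OF assms(1) \<open>1 \<le> \<sigma> p\<close> c this]
    have k: "rank n \<sigma> (\<sigma> p) c = k"
      using coord(2) * assms(7) unfolding p(3) nw by (simp add: c_def)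
    then have "\<sigma> p = i + k" using coord(1) assms(6) unfolding p(3) nw by (simp add: m_def)
    moreover have "(\<sigma> p, c) \<in> diagram n \<sigma>"
      using p(1,2) \<open>1 \<le> \<sigma> p\<close> diagram_iff[OF assms(1)] by blast
    ultimately show "(i + k, j + k) \<in> diagram n \<sigma> \<and> k = rank n \<sigma> (i + k) (j + k)"
      using k unfolding c_def by simp
  next
    assume *: "(i + k, j + k) \<in> diagram n \<sigma> \<and> k = rank n \<sigma> (i + k) (j + k)"
    then have "(i + k, c) \<in> diagram n \<sigma>" by (simp add: c_def)
    then obtain p where p: "\<sigma> p = i + k" "c < p" "\<sigma> p < \<sigma> c"
      unfolding diagram_iff[OF assms(1)] by metis
    note coord = cell_coordinates[OF assms(2) bij p(2,3)]
    have "1 \<le> \<sigma> p" using p(1) assms(6) by simp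
    have "c \<le> Suc n" using permutes_inversion_bounds(2)[OF assms(1) p(2,3)] p(2) by simp
    note nw = card_northwest[OF assms(1) \<open>1 \<le> \<sigma> p\<close> c this]
    have k: "rank n \<sigma> (\<sigma> p) c = k" using * p(1) by (simp add: c_def)
    have m: "card {d. c < d \<and> \<sigma> d < \<sigma> p} = m"
      using coord(1) p(1) assms(6) unfolding nw k by (simp add: m_def)
    have "card {d. d < c \<and> m < lehmer_code \<sigma> d} = j - 1"
      using coord(2) unfolding nw k m by (simp add: c_def)
    moreover have "{d. c < d \<and> \<sigma> d < \<sigma> p} \<subset> {d. c < d \<and> \<sigma> d < \<sigma> c}"
      using p(2,3) less_trans by blast
    from psubset_card_mono[OF finite_lehmer_code_set[OF inj, of c] this] have "m < lehmer_code \<sigma> c"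
      unfolding lehmer_code_def m .
    ultimately show "cell_contains P i j ((i + j - 1) + k)" using cell by blast
  qed
qed


section \<open>A tableau is determined by its shifted cells\<close>

lemma cell_contains_unique:
  "cell_contains P i j x \<Longrightarrow> cell_contains P i j y \<Longrightarrow> x = y"
  by (auto simp: cell_contains_def)

lemma cell_left:
  assumes "tableau P" "cell_contains P i (Suc j) x" "1 \<le> j"
  shows "\<exists>y < x. cell_contains P i j y"
proof -
  have i: "1 \<le> i" "i \<le> length P" and j: "j < length (P ! (i - 1))" "P ! (i - 1) ! j = x"
    using assms(2) by (auto simp: cell_contains_def)
  have "sorted_wrt (<) (P ! (i - 1))" using tableau_row_sorted[OF assms(1)] i by simp
  then have "P ! (i - 1) ! (j - 1) < x"
    using sorted_wrt_nth_less[of "(<)" "P ! (i - 1)" "j - 1" j] j assms(3) by simp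
  moreover have "cell_contains P i j (P ! (i - 1) ! (j - 1))"
    using i j assms(3) by (simp add: cell_contains_def)
  ultimately show ?thesis by blast
qed

lemma tableau_column_strict:
  "tableau P \<Longrightarrow> Suc i < length P \<Longrightarrow> column_strict (set (P ! i)) (set (P ! Suc i))"
proof (induction P arbitrary: i)
  case (Cons R P)
  show ?case
  proof (cases i)
    case 0
    then show ?thesis using Cons.prems by (cases P) auto
  next
    case (Suc k)
    then show ?thesis using Cons by simp
  qed
qed simp

lemma cell_up:
  assumes "tableau P" "cell_contains P (Suc i) j x" "1 \<le> i"
  shows "\<exists>y < x. cell_contains P i j y"
proof -
  obtain l where l: "i = Suc l" using assms(3) by (cases i) auto
  define R where "R = P ! l"
  define S where "S = P ! Suc l"
  have len: "Suc l < length P" and j: "1 \<le> j" "j - 1 < length S" "S ! (j - 1) = x"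
    using assms(2) by (auto simp: cell_contains_def l S_def)
  have sorted: "sorted_wrt (<) R" "sorted_wrt (<) S"
    using tableau_row_sorted[OF assms(1)] len by (auto simp: R_def S_def)
  have "{s \<in> set S. s \<le> x} = insert x {s \<in> set S. s < x}"
    using j(2,3) nth_mem by auto
  then have "card {s \<in> set S. s \<le> x} = j"
    using card_less_nth[OF sorted(2) j(2)] j(1,3) by simp
  then have R: "j \<le> card {r \<in> set R. r < x}"
    using tableau_column_strict[OF assms(1) len] unfolding column_strict_def R_def S_def by metis
  also have "\<dots> \<le> length R" by (rule order_trans[OF card_mono card_length]) auto
  finally have j': "j - 1 < length R" using j(1) by simp
  have "R ! (j - 1) < x"
  proof (rule ccontr)
    assume "\<not> R ! (j - 1) < x"
    then have "card {r \<in> set R. r < x} \<le> card {r \<in> set R. r < R ! (j - 1)}"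
      by (intro card_mono) auto
    then show False using R card_less_nth[OF sorted(1) j'] j(1) by simp
  qed
  moreover have "cell_contains P i j (R ! (j - 1))"
    using len j(1) j' by (auto simp: cell_contains_def l R_def)
  ultimately show ?thesis by blast
qed

text \<open>Each step up and each step to the left lowers the entry, while \<open>i + j - 1\<close>
  drops by two for both together; so the excess \<open>k\<close> does not decrease along a
  diagonal.\<close>

lemma cell_northwest:
  assumes "tableau P" "cell_contains P (i + t) (j + t) x" "1 \<le> i" "1 \<le> j"
  shows "\<exists>y. y + 2 * t \<le> x \<and> cell_contains P i j y"
  using assms(2)
proof (induction t arbitrary: x)
  case (Suc t)
  then obtain y where y: "y < x" "cell_contains P (i + t) (Suc (j + t)) y"
    using cell_up[OF assms(1), of "i + t" "Suc (j + t)" x] assms(3) by auto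
  then obtain z where z: "z < y" "cell_contains P (i + t) (j + t) z"
    using cell_left[OF assms(1) y(2)] assms(4) by auto
  from Suc.IH[OF z(2)] obtain u where "u + 2 * t \<le> z" "cell_contains P i j u" by blast
  with y(1) z(1) show ?case by (intro exI[of _ u]) simp
qed auto

lemma cell_entry_ge:
  assumes "tableau P" "\<forall>R \<in> set P. \<forall>y \<in> set R. 1 \<le> y" "cell_contains P i j x"
  shows "i + j - 1 \<le> x"
proof -
  have entry: "a + b + 1 \<le> x" if "cell_contains P (Suc a) (Suc b) x" for a b x
    using that
  proof (induction "a + b" arbitrary: a b x)
    case 0
    then have cell: "0 < length P" "0 < length (P ! 0)" "P ! 0 ! 0 = x"
      by (auto simp: cell_contains_def)
    have "1 \<le> x" using assms(2) nth_mem[OF cell(1)] nth_mem[OF cell(2)] cell(3) by blast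
    then show ?case using 0 by simp
  next
    case (Suc s)
    show ?case
    proof (cases b)
      case 0
      then obtain a' where a': "a = Suc a'" using Suc.hyps(2) by (cases a) auto
      obtain y where "y < x" "cell_contains P (Suc a') (Suc b) y"
        using cell_up[OF assms(1), of "Suc a'"] Suc.prems unfolding a' by auto
      then show ?thesis using Suc.hyps(1)[of a' b y] Suc.hyps(2) a' by simp
    next
      case (Suc b')
      obtain y where "y < x" "cell_contains P (Suc a) (Suc b') y"
        using cell_left[OF assms(1), of "Suc a" "Suc b'"] Suc.prems unfolding Suc by auto
      then show ?thesis using Suc.hyps(1)[of a b' y] Suc.hyps(2) Suc by simp
    qed
  qed
  have ij: "1 \<le> i" "1 \<le> j" using assms(3) by (auto simp: cell_contains_def)
  then have "cell_contains P (Suc (i - 1)) (Suc (j - 1)) x" using assms(3) by simp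
  from entry[OF this] show ?thesis using ij by simp
qed

text \<open>On a diagonal, the excess does not decrease, so the shifted positions strictly increase,
  and with a cell, a tableau contains all cells north-west of it on the diagonal. Therefore the cell
  of \<open>Q\<close> that has the same shifted position as the cell \<open>(i, j)\<close> of
  \<open>P\<close> is again \<open>(i, j)\<close>: otherwise \<open>P\<close> or \<open>Q\<close>
  would have two cells with the same shifted position. The induction on \<open>i\<close> exchanges
  the roles of \<open>P\<close> and \<open>Q\<close>.\<close>

lemma shifted_cells_determine_cells:
  assumes "tableau P" "\<forall>R \<in> set P. \<forall>y \<in> set R. 1 \<le> y"
    and "tableau Q" "\<forall>R \<in> set Q. \<forall>y \<in> set R. 1 \<le> y"
    and "shifted_cells P = shifted_cells Q" "cell_contains P i j x"
  shows "cell_contains Q i j x"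
  using assms
proof (induction i arbitrary: P Q j x rule: less_induct)
  case (less i)
  note P = less.prems(1,2) and Q = less.prems(3,4) and eq = less.prems(5)
  \<comment> \<open>Every cell of one tableau has a partner in the other with the same shifted position.\<close>
  have shifted: "\<exists>i' j' k'. 1 \<le> i' \<and> 1 \<le> j' \<and> i' + k' = i + k \<and> j' + k' = j + k \<and>
      cell_contains T' i' j' ((i' + j' - 1) + k')"
    if "cell_contains T i j ((i + j - 1) + k)" "shifted_cells T = shifted_cells T'"
    for T T' j k
  proof -
    have "1 \<le> i" "1 \<le> j" using that(1) by (auto simp: cell_contains_def)
    with that(1) have "(i + k, j + k) \<in> shifted_cells T" unfolding shifted_cells_def by blast
    then have "(i + k, j + k) \<in> shifted_cells T'" unfolding that(2) .
    then show ?thesis unfolding shifted_cells_def by force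
  qed
  have ij: "1 \<le> i" "1 \<le> j" using less.prems(6) by (auto simp: cell_contains_def)
  obtain k where x: "x = (i + j - 1) + k"
    using cell_entry_ge[OF P less.prems(6)] le_Suc_ex by blast
  obtain i' j' k' where s: "1 \<le> i'" "1 \<le> j'" "i' + k' = i + k" "j' + k' = j + k"
    and c': "cell_contains Q i' j' ((i' + j' - 1) + k')"
    using shifted[of P j k Q] less.prems(6) eq unfolding x by blast
  consider "i' = i" | "i' < i" | "i < i'" by linarith
  then show ?case
  proof cases
    case 1
    then have "j' = j" "k' = k" using s by auto
    then show ?thesis using c' 1 x by simp
  next
    case 2
    define t where "t = i - i'"
    have t: "i = i' + t" "j = j' + t" "k' = k + t" "0 < t" using 2 s by (auto simp: t_def)
    have "cell_contains P i' j' ((i' + j' - 1) + k')"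
      using less.IH[OF 2 Q P eq[symmetric] c'] .
    moreover obtain y where "y + 2 * t \<le> x" "cell_contains P i' j' y"
      using cell_northwest[OF P(1), of i' t j' x] less.prems(6) s t by auto
    ultimately have "(i' + j' - 1) + k' + 2 * t \<le> x" using cell_contains_unique by blast
    then show ?thesis using x t s by simp
  next
    case 3
    \<comment> \<open>Now \<open>Q\<close> also has the cell \<open>(i, j)\<close>, with a smaller excess \<open>l\<close>. Its partner in \<open>P\<close> lies above
      row \<open>i\<close>, so by induction it is a cell of \<open>Q\<close> too, which gives \<open>Q\<close> two cells with one shifted
      position.\<close>
    define t where "t = i' - i"
    have t: "i' = i + t" "j' = j + t" "k = k' + t" "0 < t" using 3 s by (auto simp: t_def)
    obtain y where y: "y + 2 * t \<le> (i' + j' - 1) + k'" "cell_contains Q i j y"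
      using cell_northwest[OF Q(1), of i t j] c' ij t by auto
    obtain l where l: "y = (i + j - 1) + l"
      using cell_entry_ge[OF Q y(2)] le_Suc_ex by blast
    have "l < k" using y(1) t ij unfolding l by simp
    obtain i'' j'' k'' where s': "1 \<le> i''" "1 \<le> j''" "i'' + k'' = i + l" "j'' + k'' = j + l"
      and c'': "cell_contains P i'' j'' ((i'' + j'' - 1) + k'')"
      using shifted[of Q j l P] y(2) eq unfolding l by metis
    have "i'' < i"
    proof (rule ccontr)
      assume "\<not> i'' < i"
      define u where "u = i'' - i"
      have u: "i'' = i + u" "j'' = j + u" "l = k'' + u"
        using \<open>\<not> i'' < i\<close> s' by (auto simp: u_def)
      obtain z where "z + 2 * u \<le> (i'' + j'' - 1) + k''" "cell_contains P i j z"
        using cell_northwest[OF P(1), of i u j] c'' ij u by auto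
      then have "x + 2 * u \<le> (i'' + j'' - 1) + k''"
        using cell_contains_unique less.prems(6) by blast
      then show False using x u ij \<open>l < k\<close> by simp
    qed
    define u where "u = i - i''"
    have u: "i = i'' + u" "j = j'' + u" "k'' = l + u" "0 < u"
      using \<open>i'' < i\<close> s' by (auto simp: u_def)
    have "cell_contains Q i'' j'' ((i'' + j'' - 1) + k'')"
      using less.IH[OF \<open>i'' < i\<close> P Q eq c''] .
    moreover obtain z where "z + 2 * u \<le> y" "cell_contains Q i'' j'' z"
      using cell_northwest[OF Q(1), of i'' u j'' y] y(2) s' u by auto
    ultimately have "(i'' + j'' - 1) + k'' + 2 * u \<le> y" using cell_contains_unique by blast
    then show ?thesis using l u s' by simp
  qed
qed

lemma tableau_eqI:
  assumes "tableau P" "tableau Q"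
    and cells: "\<And>i j x. cell_contains P i j x \<longleftrightarrow> cell_contains Q i j x"
  shows "P = Q"
proof -
  have sub: "length S \<le> length T \<and> (\<forall>i < length S. length (S ! i) \<le> length (T ! i) \<and>
      (\<forall>j < length (S ! i). S ! i ! j = T ! i ! j))"
    if S: "tableau S" and ST: "\<And>i j x. cell_contains S i j x \<Longrightarrow> cell_contains T i j x" for S T
  proof -
    have *: "i < length T \<and> j < length (T ! i) \<and> T ! i ! j = S ! i ! j"
      if "i < length S" "j < length (S ! i)" for i j
      using ST[of "Suc i" "Suc j" "S ! i ! j"] that by (simp add: cell_contains_def)
    have "length S \<le> length T"
    proof (rule ccontr)
      assume "\<not> ?thesis"
      then have "length T < length S" by simp
      moreover from this have "0 < length (S ! length T)" using tableau_row_sorted[OF S] by blast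
      ultimately show False using * by blast
    qed
    moreover have "length (S ! i) \<le> length (T ! i)" if "i < length S" for i
      using *[OF that] by (meson less_irrefl not_le)
    ultimately show ?thesis using * by simp
  qed
  note PQ = sub[of P Q] and QP = sub[of Q P]
  have len: "length P = length Q" using PQ QP assms by (simp add: le_antisym)
  show ?thesis
  proof (rule nth_equalityI[OF len])
    fix i assume i: "i < length P"
    have "length (P ! i) = length (Q ! i)" using PQ QP assms i len by (simp add: le_antisym)
    then show "P ! i = Q ! i" using PQ assms i by (intro nth_equalityI) auto
  qed
qed


section \<open>Existence of reduced words\<close>

text \<open>An increasing bijection satisfies \<open>y \<le> \<tau> y\<close>, and the position
  \<open>y\<close> of the value \<open>x\<close> cannot be smaller than \<open>x\<close>, as by
  induction it would be fixed.\<close>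

lemma no_descent_imp_id:
  fixes \<tau> :: "nat \<Rightarrow> nat"
  assumes "bij \<tau>" "\<And>x. \<tau> x \<le> \<tau> (Suc x)"
  shows "\<tau> = id"
proof -
  have inj: "inj \<tau>" using assms(1) by (rule bij_is_inj)
  have "\<tau> x < \<tau> (Suc x)" for x
    using assms(2)[of x] inj by (metis injD le_neq_implies_less n_not_Suc_n)
  then have mono: "strict_mono \<tau>" by (simp add: strict_mono_Suc_iff)
  have "\<tau> x = x" for x
  proof (induction x rule: less_induct)
    case (less x)
    obtain y where y: "\<tau> y = x" using bij_is_surj[OF assms(1)] by (metis surjD)
    have "y \<le> \<tau> y" by (rule strict_mono_imp_increasing[OF mono])
    then show ?case using less[of y] y by (metis le_neq_implies_less)
  qed
  then show ?thesis by (simp add: fun_eq_iff)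
qed

lemma finite_inversions_permutes:
  assumes "\<tau> permutes {1..n}"
  shows "finite (inversions \<tau>)"
proof (rule finite_subset)
  show "inversions \<tau> \<subseteq> {..n} \<times> {..n}"
    using permutes_inversion_bounds(2)[OF assms] by (fastforce simp: inversions_def)
qed simp

text \<open>Bubble sort: undo descents until none is left.\<close>

lemma reduced_word_exists:
  assumes "\<tau> permutes {1..n}"
  shows "\<exists>v. set v \<subseteq> {1..n - 1} \<and> word_perm v = \<tau> \<and> reduced v"
  using assms
proof (induction "card (inversions \<tau>)" arbitrary: \<tau> rule: less_induct)
  case less
  show ?case
  proof (cases "\<exists>x. \<tau> (Suc x) < \<tau> x")
    case True
    then obtain x where x: "\<tau> (Suc x) < \<tau> x" by blast
    have bounds: "1 \<le> x" "Suc x \<le> n"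
      using permutes_inversion_bounds[OF less.prems _ x] by auto
    define \<rho> where "\<rho> = \<tau> \<circ> Transposition.transpose x (Suc x)"
    have "\<rho> permutes {1..n}"
      unfolding \<rho>_def using bounds
      by (intro permutes_compose[OF _ less.prems] permutes_swap_id) auto
    moreover have card: "card (inversions \<tau>) = Suc (card (inversions \<rho>))"
      unfolding \<rho>_def by (rule inversions_descent(2)[OF x finite_inversions_permutes[OF less.prems]])
    ultimately obtain v where v: "set v \<subseteq> {1..n - 1}" "word_perm v = \<rho>" "reduced v"
      using less.hyps[of \<rho>] by auto
    have perm: "word_perm (v @ [x]) = \<tau>"
      unfolding word_perm_snoc v(2) \<rho>_def by (simp add: comp_assoc)
    then have "reduced (v @ [x])"
      using v(3) card v(2) by (simp add: reduced_def)
    moreover have "set (v @ [x]) \<subseteq> {1..n - 1}" using v(1) bounds by auto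
    ultimately show ?thesis using perm by blast
  next
    case False
    then have "\<tau> = id"
      using no_descent_imp_id[OF permutes_bij[OF less.prems]] by (meson not_less)
    then show ?thesis by (intro exI[of _ "[]"]) (simp add: reduced_def)
  qed
qed


section \<open>Pattern avoidance in one-line notation\<close>

lemma subseq_Cons_map_upt:
  "subseq (x # xs) (map f [m..<k]) \<longleftrightarrow>
     (\<exists>p. m \<le> p \<and> p < k \<and> x = f p \<and> subseq xs (map f [Suc p..<k]))"
proof (induction "k - m" arbitrary: m)
  case 0
  then show ?case by auto
next
  case (Suc d)
  then have m: "m < k" and IH: "subseq (x # xs) (map f [Suc m..<k]) \<longleftrightarrow>
     (\<exists>p. Suc m \<le> p \<and> p < k \<and> x = f p \<and> subseq xs (map f [Suc p..<k]))"
    by auto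
  have split: "[m..<k] = m # [Suc m..<k]" using m by (rule upt_conv_Cons)
  have "subseq (x # xs) (map f [m..<k]) \<longleftrightarrow>
      x = f m \<and> subseq xs (map f [Suc m..<k]) \<or> subseq (x # xs) (map f [Suc m..<k])"
    unfolding split using subseq_Cons' by auto
  also have "\<dots> \<longleftrightarrow> (\<exists>p. m \<le> p \<and> p < k \<and> x = f p \<and> subseq xs (map f [Suc p..<k]))"
    unfolding IH using m by (metis Suc_leD Suc_leI le_neq_implies_less order_refl)
  finally show ?case .
qed

lemma same_relative_order_2143:
  "same_relative_order xs [2, 1, 4, 3] \<longleftrightarrow>
     (\<exists>a b c d. xs = [a, b, c, d] \<and> b < a \<and> a < d \<and> d < c)"
proof
  assume *: "same_relative_order xs [2, 1, 4, 3]"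
  then have "length xs = 4" by (simp add: same_relative_order_def)
  then obtain a b c d where xs: "xs = [a, b, c, d]"
    by (auto simp: length_Suc_conv numeral_eq_Suc)
  have "xs ! i < xs ! j \<longleftrightarrow> [2, 1, 4, 3 :: nat] ! i < [2, 1, 4, 3] ! j" if "i < 4" "j < 4" for i j
    using * that \<open>length xs = 4\<close> unfolding same_relative_order_def by metis
  from this[of 1 0] this[of 0 3] this[of 3 2] have "b < a \<and> a < d \<and> d < c"
    by (simp add: xs)
  with xs show "\<exists>a b c d. xs = [a, b, c, d] \<and> b < a \<and> a < d \<and> d < c" by blast
next
  assume "\<exists>a b c d. xs = [a, b, c, d] \<and> b < a \<and> a < d \<and> d < c"
  then show "same_relative_order xs [2, 1, 4, 3]"
    by (auto simp: same_relative_order_def less_Suc_eq numeral_eq_Suc)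
qed

lemma vexillary_iff_avoids_2143:
  assumes "\<sigma> permutes {1..n}"
  shows "vexillary n \<sigma> \<longleftrightarrow> avoids_2143 \<sigma>"
proof -
  have "(\<exists>xs. subseq xs (one_line n \<sigma>) \<and> same_relative_order xs [2, 1, 4, 3]) \<longleftrightarrow>
    (\<exists>a b c d. 1 \<le> a \<and> a < b \<and> b < c \<and> c < d \<and> d \<le> n \<and>
      \<sigma> b < \<sigma> a \<and> \<sigma> a < \<sigma> d \<and> \<sigma> d < \<sigma> c)"
    (is "?L \<longleftrightarrow> ?R")
  proof
    assume ?L
    then obtain x y z u where s: "subseq [x, y, z, u] (map \<sigma> [1..<n + 1])"
      and o: "y < x" "x < u" "u < z"
      unfolding same_relative_order_2143 one_line_def by blast
    from s obtain a b c d where "1 \<le> a" "Suc a \<le> b" "Suc b \<le> c" "Suc c \<le> d" "d < n + 1"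
      "x = \<sigma> a" "y = \<sigma> b" "z = \<sigma> c" "u = \<sigma> d"
      unfolding subseq_Cons_map_upt by blast
    with o show ?R by (intro exI[of _ a] exI[of _ b] exI[of _ c] exI[of _ d]) simp
  next
    assume ?R
    then obtain a b c d where p: "1 \<le> a" "a < b" "b < c" "c < d" "d \<le> n"
      and o: "\<sigma> b < \<sigma> a" "\<sigma> a < \<sigma> d" "\<sigma> d < \<sigma> c" by blast
    have "subseq [\<sigma> d] (map \<sigma> [Suc c..<n + 1])"
      by (subst subseq_Cons_map_upt, rule exI[of _ d]) (use p in simp)
    then have "subseq [\<sigma> c, \<sigma> d] (map \<sigma> [Suc b..<n + 1])"
      by (subst subseq_Cons_map_upt, intro exI[of _ c]) (use p in simp)
    then have "subseq [\<sigma> b, \<sigma> c, \<sigma> d] (map \<sigma> [Suc a..<n + 1])"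
      by (subst subseq_Cons_map_upt, intro exI[of _ b]) (use p in simp)
    then have "subseq [\<sigma> a, \<sigma> b, \<sigma> c, \<sigma> d] (map \<sigma> [1..<n + 1])"
      by (subst subseq_Cons_map_upt, intro exI[of _ a]) (use p in simp)
    then show ?L using o unfolding same_relative_order_2143 one_line_def by blast
  qed
  also have "\<dots> \<longleftrightarrow> \<not> avoids_2143 \<sigma>"
    unfolding avoids_2143_def
    using permutes_inversion_bounds[OF assms] by blast
  finally show ?thesis unfolding vexillary_def by blast
qed

lemma inv_number_eq_card_inversions:
  assumes "\<sigma> permutes {1..n}"
  shows "inv_number n \<sigma> = card (inversions \<sigma>)"
proof -
  have "{(i, j). i \<in> {1..n} \<and> j \<in> {1..n} \<and> i < j \<and> \<sigma> j < \<sigma> i} = inversions \<sigma>"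
    using permutes_inversion_bounds[OF assms] by (fastforce simp: inversions_def)
  then show ?thesis by (simp add: inv_number_def)
qed


section \<open>Insertion tableaux of vexillary permutations\<close>

lemma rank_less:
  assumes "\<sigma> permutes {1..n}" "(r, c) \<in> diagram n \<sigma>"
  shows "rank n \<sigma> r c < r" "rank n \<sigma> r c < c"
proof -
  have rc: "1 \<le> r" "1 \<le> c" "c \<le> Suc n" using assms(2) by (auto simp: diagram_def)
  have "card {d. d < c \<and> \<sigma> d < r} \<le> card {d. \<sigma> d < r}"
    using finite_less_vimage[OF permutes_inj[OF assms(1)]] by (intro card_mono) auto
  moreover have "card {d. d < c \<and> \<sigma> d < r} \<le> card {..<c}" by (intro card_mono) auto
  ultimately show "rank n \<sigma> r c < r" "rank n \<sigma> r c < c"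
    using card_northwest[OF assms(1) rc] card_smaller_values[OF permutes_bij[OF assms(1)]]
    by simp_all
qed

text \<open>What is known of insertion tableaux; the remaining arguments apply to any tableau with
  these properties.\<close>

lemma insertion_tableau_properties:
  assumes "\<sigma> permutes {1..n}" "w \<in> reduced_words n \<sigma>"
  shows "tableau (insertion_tableau w)" "reduced (reading_word (insertion_tableau w))"
    "word_perm (reading_word (insertion_tableau w)) = \<sigma>"
    "\<forall>R \<in> set (insertion_tableau w). \<forall>y \<in> set R. 1 \<le> y"
proof -
  have w: "word_perm w = \<sigma>" "reduced w" "\<forall>x \<in> set w. 1 \<le> x"
    using assms(2) inv_number_eq_card_inversions[OF assms(1)]
    by (auto simp: reduced_words_def reduced_def)
  note EG = insertion_tableau_reading_word[OF w(2)]
  show "tableau (insertion_tableau w)" using EG by blast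
  show "word_perm (reading_word (insertion_tableau w)) = \<sigma>" using EG w(1) by simp
  show "reduced (reading_word (insertion_tableau w))" using EG w(2) reduced_cong by blast
  show "\<forall>R \<in> set (insertion_tableau w). \<forall>y \<in> set R. 1 \<le> y"
    by (rule insertion_tableau_entries_ge[OF w(3)])
qed

text \<open>The cell of \<open>P\<close> that is shifted to \<open>(r, c)\<close> is \<open>(r - k,
  c - k)\<close> with \<open>k\<close> the rank of \<open>(r, c)\<close>; its coordinates are
  positive by \<open>rank_less\<close>.\<close>

lemma shifted_cells_vexillary:
  assumes "\<tau> permutes {1..n}" "avoids_2143 \<tau>"
    and "tableau P" "reduced (reading_word P)" "word_perm (reading_word P) = \<tau>"
  shows "shifted_cells P = diagram n \<tau>"
proof
  note cells = vexillary_tableau_cells[OF assms]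
  show "shifted_cells P \<subseteq> diagram n \<tau>"
    unfolding shifted_cells_def using cells by auto
  show "diagram n \<tau> \<subseteq> shifted_cells P"
  proof clarify
    fix r c assume rc: "(r, c) \<in> diagram n \<tau>"
    define k where "k = rank n \<tau> r c"
    define i where "i = r - k"
    define j where "j = c - k"
    have ij: "1 \<le> i" "1 \<le> j" "r = i + k" "c = j + k"
      using rank_less[OF assms(1) rc] by (auto simp: i_def j_def k_def)
    have "cell_contains P i j ((i + j - 1) + k)"
      unfolding cells[OF ij(1,2)] ij(3,4)[symmetric] using rc by (simp add: k_def)
    then show "(r, c) \<in> shifted_cells P" unfolding shifted_cells_def using ij by blast
  qed
qed

theorem theorem3p15:
  fixes n :: nat and \<sigma> :: "nat \<Rightarrow> nat" and w :: "nat list"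
  assumes "\<sigma> permutes {1..n}"
    and "w \<in> reduced_words n \<sigma>"
  shows "(vexillary n \<sigma> \<longrightarrow>
           (\<forall>i \<ge> 1. \<forall>j \<ge> 1. \<forall>k.
              cell_contains (insertion_tableau w) i j ((i + j - 1) + k) \<longleftrightarrow>
              (i + k, j + k) \<in> diagram n \<sigma> \<and> k = rank n \<sigma> (i + k) (j + k)))
       \<and> ((\<exists>N \<tau>. \<tau> permutes {1..N} \<and> vexillary N \<tau> \<and>
              shifted_cells (insertion_tableau w) = diagram N \<tau>) \<longrightarrow>
           vexillary n \<sigma>)"
proof (intro conjI impI)
  note P = insertion_tableau_properties[OF assms]
  show "\<forall>i \<ge> 1. \<forall>j \<ge> 1. \<forall>k.
      cell_contains (insertion_tableau w) i j ((i + j - 1) + k) \<longleftrightarrow>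
      (i + k, j + k) \<in> diagram n \<sigma> \<and> k = rank n \<sigma> (i + k) (j + k)"
    if "vexillary n \<sigma>"
    using that vexillary_tableau_cells[OF assms(1) _ P(1-3)]
    unfolding vexillary_iff_avoids_2143[OF assms(1)] by blast
  assume "\<exists>N \<tau>. \<tau> permutes {1..N} \<and> vexillary N \<tau> \<and>
      shifted_cells (insertion_tableau w) = diagram N \<tau>"
  then obtain N \<tau> where \<tau>: "\<tau> permutes {1..N}" "avoids_2143 \<tau>"
    "shifted_cells (insertion_tableau w) = diagram N \<tau>"
    using vexillary_iff_avoids_2143 by blast
  obtain v where "set v \<subseteq> {1..N - 1}" "word_perm v = \<tau>" "reduced v"
    using reduced_word_exists[OF \<tau>(1)] by blast
  then have "v \<in> reduced_words N \<tau>"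
    using inv_number_eq_card_inversions[OF \<tau>(1)] by (simp add: reduced_words_def reduced_def)
  note Q = insertion_tableau_properties[OF \<tau>(1) this]
  have eq: "shifted_cells (insertion_tableau w) = shifted_cells (insertion_tableau v)"
    using shifted_cells_vexillary[OF \<tau>(1,2) Q(1-3)] \<tau>(3) by simp
  have "insertion_tableau w = insertion_tableau v"
    using shifted_cells_determine_cells[OF P(1,4) Q(1,4) eq]
      shifted_cells_determine_cells[OF Q(1,4) P(1,4) eq[symmetric]]
    by (intro tableau_eqI P(1) Q(1)) blast
  then have "\<sigma> = \<tau>" using P(3) Q(3) by simp
  then show "vexillary n \<sigma>" using \<tau>(2) vexillary_iff_avoids_2143[OF assms(1)] by simp
qed

end
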